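(* Let $G$ be a connected $(P_7,C_4,C_3)$-free graph without clique cutsets. If $G$ is not a complete graph, then $G$ is (isomorphic to a graph) in $\mathfrak{F}$.
   Context: All graphs are finite and simple. $C_k$ is the cycle on $k$ vertices and $P_k$ the path on $k$ vertices. A graph is $(H_1,H_2,\dots)$-free if it has no induced subgraph isomorphic to any $H_i$. A clique cutset of $G$ is a clique $K$ such that $G-K$ has more components than $G$. The family $\mathfrak{F}=\{F_0,F_0',F_1,F_2,\dots,F_{12}\}$, where $F_0'$ and $F_2$ stand for all graphs obtained for positive integer parameters $t'$ and $t$ respectively, is as follows. $F_0=C_6$. $F_0'$ (parameter $t'\ge1$): a 6-cycle $v_1v_2\cdots v_6v_1$ plus vertices $y_1,\dots,y_{t'},z_1,\dots,z_{t'}$ with added edges $v_1y_j$, $y_jz_j$, $z_jv_4$ for $1\le j\le t'$. For $F_1,\dots,F_4$ let $v_1v_2v_3v_4v_5v_1$ be a 5-cycle. $F_1=C_5$. $F_2$ (parameter $t\ge1$): the 5-cycle plus vertices $y_1,\dots,y_t,z_1,\dots,z_t$ with added edges $v_1y_j$, $y_jz_j$, $z_jv_3$ for $1\le j\le t$. $F_3$: the 5-cycle plus $a_1,a_3,a_4$ with added edges $a_iv_i$ $(i=1,3,4)$, $a_1a_3$, $a_1a_4$. $F_4$: the 5-cycle plus $a_1,a_3,a_4,a_5$ with added edges $a_iv_i$ $(i=1,3,4,5)$, $a_1a_3$, $a_1a_4$, $a_3a_5$. $F_5$ is the Petersen graph. For $F_6,\dots,F_{12}$ let $x_1x_2\cdots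 x_7x_1$ be a 7-cycle, let $x_8$ be a vertex adjacent to $x_2,x_6$, let $x_9$ be adjacent to $x_3,x_7$, let $x_{10}$ be adjacent to $x_8,x_9$, and let $x_{11}$ be adjacent to $x_3,x_6$, with no other edges. $F_{12}$ is this whole graph on $\{x_1,\dots,x_{11}\}$, and, as induced subgraphs of $F_{12}$: $F_6=C_7$ is induced by $\{x_1,\dots,x_7\}$; $F_7$ by $\{x_1,\dots,x_7,x_8\}$; $F_8$ by $\{x_1,\dots,x_9\}$; $F_9$ by $\{x_1,\dots,x_{10}\}$; $F_{10}$ by $\{x_1,\dots,x_7,x_9,x_{11}\}$; $F_{11}$ by $\{x_1,\dots,x_9,x_{11}\}$. *)

theory Defs
  imports
    "Graph_Theory.Kuratowski"
    "Graph_Theory.Digraph_Isomorphism"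
begin

text \<open>
  Graphs follow the convention of Graph_Theory: the locale \<^locale>\<open>graph\<close> (or, with arcs given
  as pairs of vertices, \<^locale>\<open>pair_graph\<close>) describes finite loop-free symmetric digraphs without
  parallel arcs, i.e. finite simple graphs. An undirected edge is a pair of opposite arcs.
\<close>

definition ugraph :: "'a set \<Rightarrow> 'a rel \<Rightarrow> 'a pair_pre_digraph" where
  "ugraph U E = \<lparr> pverts = U, parcs = symcl E \<rparr>"

definition cycle_edges :: "(nat \<Rightarrow> 'a) \<Rightarrow> nat \<Rightarrow> 'a rel" where
  "cycle_edges f k = {(f i, f (if i = k then 1 else Suc i)) | i. 1 \<le> i \<and> i \<le> k}"

definition cycle_graph :: "nat \<Rightarrow> nat pair_pre_digraph" where
  "cycle_graph k = ugraph {1..k} (cycle_edges (\<lambda>i. i) k)"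

definition path_graph :: "nat \<Rightarrow> nat pair_pre_digraph" where
  "path_graph k = ugraph {1..k} {(i, Suc i) | i. 1 \<le> i \<and> i < k}"

definition induced_free :: "('c,'d) pre_digraph \<Rightarrow> ('a,'b) pre_digraph \<Rightarrow> bool" where
  "induced_free H G \<longleftrightarrow> \<not> (\<exists>I. induced_subgraph I G \<and> digraph_iso I H)"

definition clique :: "('a,'b) pre_digraph \<Rightarrow> 'a set \<Rightarrow> bool" where
  "clique G K \<longleftrightarrow> K \<subseteq> verts G \<and> (\<forall>u\<in>K. \<forall>v\<in>K. u \<noteq> v \<longrightarrow> u \<rightarrow>\<^bsub>G\<^esub> v)"

text \<open>In a symmetric digraph the strongly connected components are the connected components.\<close>

definition clique_cutset :: "('a,'b) pre_digraph \<Rightarrow> 'a set \<Rightarrow> bool" where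
  "clique_cutset G K \<longleftrightarrow> clique G K \<and>
     card (pre_digraph.sccs (G \<restriction> (verts G - K))) > card (pre_digraph.sccs G)"

text \<open>
  One type of labels for the vertices of all members of the family: \<open>Vv i\<close> is $v_i$, \<open>Va i\<close> is
  $a_i$, and so on.
\<close>

datatype label = Vv nat | Va nat | Vx nat | Vy nat | Vz nat

type_synonym label_graph = "(label, label \<times> label) pre_digraph"

definition F0 :: label_graph where
  "F0 = with_proj (ugraph (Vv ` {1..6}) (cycle_edges Vv 6))"

definition F0' :: "nat \<Rightarrow> label_graph" where
  "F0' t = with_proj (ugraph (Vv ` {1..6} \<union> Vy ` {1..t} \<union> Vz ` {1..t})
     (cycle_edges Vv 6 \<union> (\<Union>j\<in>{1..t}. {(Vv 1, Vy j), (Vy j, Vz j), (Vz j, Vv 4)})))"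

definition F1 :: label_graph where
  "F1 = with_proj (ugraph (Vv ` {1..5}) (cycle_edges Vv 5))"

definition F2 :: "nat \<Rightarrow> label_graph" where
  "F2 t = with_proj (ugraph (Vv ` {1..5} \<union> Vy ` {1..t} \<union> Vz ` {1..t})
     (cycle_edges Vv 5 \<union> (\<Union>j\<in>{1..t}. {(Vv 1, Vy j), (Vy j, Vz j), (Vz j, Vv 3)})))"

definition F3 :: label_graph where
  "F3 = with_proj (ugraph (Vv ` {1..5} \<union> Va ` {1, 3, 4})
     (cycle_edges Vv 5 \<union> {(Va i, Vv i) | i. i \<in> {1, 3, 4}} \<union>
      {(Va 1, Va 3), (Va 1, Va 4)}))"

definition F4 :: label_graph where
  "F4 = with_proj (ugraph (Vv ` {1..5} \<union> Va ` {1, 3, 4, 5})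
     (cycle_edges Vv 5 \<union> {(Va i, Vv i) | i. i \<in> {1, 3, 4, 5}} \<union>
      {(Va 1, Va 3), (Va 1, Va 4), (Va 3, Va 5)}))"

text \<open>The Petersen graph, drawn as an outer 5-cycle, five spokes, and an inner pentagram.\<close>

definition F5 :: label_graph where
  "F5 = with_proj (ugraph (Vv ` {1..5} \<union> Va ` {1..5})
     (cycle_edges Vv 5 \<union> {(Va i, Vv i) | i. i \<in> {1..5}} \<union>
      {(Va 1, Va 3), (Va 3, Va 5), (Va 5, Va 2), (Va 2, Va 4), (Va 4, Va 1)}))"

definition F12 :: label_graph where
  "F12 = with_proj (ugraph (Vx ` {1..11})
     (cycle_edges Vx 7 \<union>
      {(Vx 8, Vx 2), (Vx 8, Vx 6), (Vx 9, Vx 3), (Vx 9, Vx 7),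
       (Vx 10, Vx 8), (Vx 10, Vx 9), (Vx 11, Vx 3), (Vx 11, Vx 6)}))"

definition F6 :: label_graph where "F6 = F12 \<restriction> (Vx ` {1..7})"
definition F7 :: label_graph where "F7 = F12 \<restriction> (Vx ` {1..8})"
definition F8 :: label_graph where "F8 = F12 \<restriction> (Vx ` {1..9})"
definition F9 :: label_graph where "F9 = F12 \<restriction> (Vx ` {1..10})"
definition F10 :: label_graph where "F10 = F12 \<restriction> (Vx ` ({1..7} \<union> {9, 11}))"
definition F11 :: label_graph where "F11 = F12 \<restriction> (Vx ` ({1..9} \<union> {11}))"

definition frak_F :: "label_graph set" where
  "frak_F = {F0, F1, F3, F4, F5, F6, F7, F8, F9, F10, F11, F12}
     \<union> {F0' t | t. t \<ge> 1} \<union> {F2 t | t. t \<ge> 1}"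

end

theory Submission
  imports Defs
begin

text \<open>
  Triangle-freeness and the absence of induced 4-cycles mean girth at least 5. A cut vertex is a
  clique cutset, so \<open>G\<close>, being connected and not complete, has minimum degree at least two, and
  walking on without turning back until the walk would induce a path on seven vertices produces
  an induced cycle of length 5, 6 or 7 (\<open>ex_cyc\<close>). The proof describes the graph around such a cycle.

  The method is the same in all three cases. Girth limits how vertices off the cycle can be joined to
  it and to each other; a vertex too far from the cycle, or two attachments in unsuitable
  positions, extend a segment of the cycle to an induced path on seven vertices; and minimum degree two
  gives every attached vertex a partner.

  If there is a 7-cycle, an outside vertex with a neighbour on it has exactly two, at distance 3. Such a
  handle is determined by its index modulo 7, and the indices of two handles cannot differ by 2
  (\<open>no_handles_at_distance_2\<close>). So there are at most three handles, up to rotation those of \<open>F12\<close>. A vertex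
  further out is adjacent to two handles with consecutive indices (\<open>outer_pair\<close>), so there is at most one.
  The result is one of \<open>F6\<close> to \<open>F12\<close>.

  If there is a 5-cycle and no 7-cycle, every outside vertex has exactly one neighbour on the
  cycle (\<open>C5_dominates\<close>), and adjacent outside vertices are attached at positions at distance 2. Call such
  an edge a link of type \<open>i\<close> if it joins positions \<open>i\<close> and \<open>i + 2\<close>. Links of types \<open>i\<close> and \<open>i + 2\<close> meet in
  one vertex (\<open>links_share_end\<close>), and links of types \<open>i\<close> and \<open>i + 1\<close> force one of type \<open>i + 3\<close>
  (\<open>links_consecutive\<close>). Hence the types that occur form an interval in the cyclic order of the
  pentagram. The empty interval gives \<open>F1\<close>, a single type gives a matching and thus \<open>F2\<close>, and longer intervals
  give a single path or cycle of links, that is \<open>F3\<close>, \<open>F4\<close> or the Petersen graph \<open>F5\<close>.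

  If there is a 6-cycle and no 5-cycle, outside vertices are again attached at one position each, edges
  between them join opposite positions, and two such edges at different pairs of positions
  contain an induced path on seven vertices (\<open>no_crossing_pairs\<close>). This leaves \<open>F0\<close> and \<open>F0'\<close>.
\<close>

section \<open>Isomorphisms, components and explicit small graphs\<close>

lemma induce_subgraph_with_proj:
  "with_proj P \<restriction> X = with_proj \<lparr> pverts = X, parcs = {e \<in> parcs P. fst e \<in> X \<and> snd e \<in> X} \<rparr>"
  by (simp add: induce_subgraph_def with_proj_def)

text \<open>
  An isomorphism in the sense of \<^const>\<open>digraph_iso\<close> also maps arcs, heads and tails. For graphs whose
  arcs are pairs all of this is induced by the vertex map, so an adjacency-preserving labelling
  \<open>g\<close> is enough.
\<close>

lemma (in pair_wf_digraph) induced_copy_iso: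
  assumes P: "parcs P \<subseteq> pverts P \<times> pverts P"
    and g: "inj_on g (pverts P)" "g ` pverts P \<subseteq> pverts G"
    and adj: "\<And>u v. u \<in> pverts P \<Longrightarrow> v \<in> pverts P \<Longrightarrow> (g u, g v) \<in> parcs G \<longleftrightarrow> (u, v) \<in> parcs P"
  shows "digraph_iso (with_proj G \<restriction> (g ` pverts P)) (with_proj P)"
proof -
  let ?I = "with_proj G \<restriction> (g ` pverts P)"
  define f where "f = the_inv_into (pverts P) g"
  have f: "f (g u) = u" if "u \<in> pverts P" for u
    using that g(1) by (simp add: f_def the_inv_into_f_f)
  have arcs_I: "arcs ?I = (\<lambda>(u, v). (g u, g v)) ` parcs P"
  proof
    show "arcs ?I \<subseteq> (\<lambda>(u, v). (g u, g v)) ` parcs P"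
      by (auto simp: adj)
    show "(\<lambda>(u, v). (g u, g v)) ` parcs P \<subseteq> arcs ?I"
      using P adj by auto
  qed
  let ?f = "\<lparr> iso_verts = f, iso_arcs = (\<lambda>(u, v). (f u, f v)), iso_head = snd, iso_tail = fst \<rparr>"
  have inj: "inj_on f (g ` pverts P)"
    by (auto simp: inj_on_def f)
  moreover have "inj_on (\<lambda>(u, v). (f u, f v)) (arcs ?I)"
    by (rule inj_on_subset[OF map_prod_inj_on[OF inj inj, unfolded map_prod_def]]) auto
  ultimately have "pre_digraph.digraph_isomorphism ?I ?f"
    by (auto simp: pre_digraph.digraph_isomorphism_def)
  moreover have "(\<lambda>(u, v). (f u, f v)) ` arcs ?I = parcs P"
    unfolding arcs_I image_image using P f by (force simp: case_prod_beta image_iff)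
  moreover have "f ` g ` pverts P = pverts P"
    using f by (force simp: image_image)
  ultimately show ?thesis
    unfolding digraph_iso_def app_iso_def with_proj_def
    by (intro exI[of _ ?f]) (simp add: with_proj_def)
qed

text \<open>
  In a symmetric digraph the set reachable from a vertex is a component. A vertex inside \<open>Q\<close> and one
  outside give two different components.
\<close>

lemma card_sccs_disconnected:
  assumes H: "fin_digraph H" "sym_digraph H"
    and Q: "Q \<subseteq> verts H" "Q \<noteq> {}" "Q \<noteq> verts H"
    and closed: "\<And>u v. u \<rightarrow>\<^bsub>H\<^esub> v \<Longrightarrow> u \<in> Q \<Longrightarrow> v \<in> Q"
  shows "1 < card (pre_digraph.sccs H)"
proof -
  interpret fin_digraph H by fact
  interpret sym_digraph H by fact
  obtain u v where u: "u \<in> Q" and v: "v \<in> verts H" "v \<notin> Q"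
    using Q by blast
  have reach: "w \<in> Q" if "u \<rightarrow>\<^sup>*\<^bsub>H\<^esub> w" for w
    using that by (induction rule: reachable_induct) (use u closed in auto)
  let ?C = "\<lambda>u. H \<restriction> {w. u \<rightarrow>\<^sup>*\<^bsub>H\<^esub> w}"
  have "v \<in> verts (?C v)" "v \<notin> verts (?C u)"
    using v reach by auto
  then have "?C u \<noteq> ?C v"
    by metis
  moreover have "{?C u, ?C v} \<subseteq> sccs"
    using u v Q induce_reachable_is_in_sccs by auto
  moreover have "finite sccs"
    using finite_sccs_verts sccs_conv_sccs_verts by simp
  ultimately show ?thesis
    by (metis card_2_iff card_mono one_less_numeral_iff order_less_le_trans semiring_norm(76))
qed

lemma ugraph_arcs: "E \<subseteq> U \<times> U \<Longrightarrow> parcs (ugraph U E) \<subseteq> pverts (ugraph U E) \<times> pverts (ugraph U E)"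
  by (auto simp: ugraph_def symcl_def)

text \<open>
  Patterns have vertices \<open>1, \<dots>, n\<close>, lists are indexed from 0; a dummy head aligns the two.
\<close>

lemma inj_on_nth_Cons: "distinct xs \<Longrightarrow> length xs = n \<Longrightarrow> inj_on ((!) (x # xs)) {1..n}"
  by (auto simp: inj_on_def nth_eq_iff_index_eq)

lemma ivl_numeral:
  "{Suc 0..3} = {1,2,3}" "{Suc 0..4} = {1,2,3,4}" "{Suc 0..5} = {1,2,3,4,5}"
  "{Suc 0..6} = {1,2,3,4,5,6}" "{Suc 0..7} = {1,2,3,4,5,6,7}"
  by auto

lemma cycle_edges_explicit:
  "cycle_edges f 3 = {(f 1, f 2), (f 2, f 3), (f 3, f 1)}"
  "cycle_edges f 4 = {(f 1, f 2), (f 2, f 3), (f 3, f 4), (f 4, f 1)}"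
  "cycle_edges f 5 = {(f 1, f 2), (f 2, f 3), (f 3, f 4), (f 4, f 5), (f 5, f 1)}"
  "cycle_edges f 6 = {(f 1, f 2), (f 2, f 3), (f 3, f 4), (f 4, f 5), (f 5, f 6), (f 6, f 1)}"
  "cycle_edges f 7 = {(f 1, f 2), (f 2, f 3), (f 3, f 4), (f 4, f 5), (f 5, f 6), (f 6, f 7), (f 7, f 1)}"
proof -
  have "cycle_edges f k = (\<lambda>i. (f i, f (if i = k then 1 else Suc i))) ` {1..k}" for k
    by (auto simp: cycle_edges_def)
  then show
  "cycle_edges f 3 = {(f 1, f 2), (f 2, f 3), (f 3, f 1)}"
  "cycle_edges f 4 = {(f 1, f 2), (f 2, f 3), (f 3, f 4), (f 4, f 1)}"
  "cycle_edges f 5 = {(f 1, f 2), (f 2, f 3), (f 3, f 4), (f 4, f 5), (f 5, f 1)}"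
  "cycle_edges f 6 = {(f 1, f 2), (f 2, f 3), (f 3, f 4), (f 4, f 5), (f 5, f 6), (f 6, f 1)}"
  "cycle_edges f 7 = {(f 1, f 2), (f 2, f 3), (f 3, f 4), (f 4, f 5), (f 5, f 6), (f 6, f 7), (f 7, f 1)}"
    by (simp_all only: ivl_numeral image_insert image_empty One_nat_def) (simp_all add: eval_nat_numeral)
qed

lemma path_graph_7:
  "path_graph 7 = ugraph {1..7} {(1,2), (2,3), (3,4), (4,5), (5,6), (6,7)}"
proof -
  have "{(i, Suc i) | i. 1 \<le> i \<and> i < (7::nat)} = (\<lambda>i. (i, Suc i)) ` {1..6}"
    by auto
  then have "{(i, Suc i) | i. 1 \<le> i \<and> i < (7::nat)} = {(1,2), (2,3), (3,4), (4,5), (5,6), (6,7)}"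
    by (simp only: ivl_numeral image_insert image_empty One_nat_def) (simp add: eval_nat_numeral)
  then show ?thesis
    by (simp only: path_graph_def)
qed

section \<open>Residues and labels\<close>

lemma nat_mod_eq_imp_eq:
  assumes "(int i - int j) mod int n = 0" "i \<in> {1..n}" "j \<in> {1..n}"
  shows "i = j"
proof -
  have "int n dvd int i - int j" using assms(1) by (simp add: mod_eq_0_iff_dvd)
  then show "i = j"
    using assms zdvd_imp_le[of "int n" "int i - int j"] zdvd_imp_le[of "int n" "int j - int i"]
    by (cases i j rule: linorder_cases) (auto simp: dvd_diff_commute)
qed

lemma mod_diff_swap: "(i - j) mod n = (if (j - i) mod n = 0 then 0 else n - (j - i) mod n)" for i j n :: int
  using zmod_zminus1_eq_if[of "j - i" n] by simp

lemma mod5_cases: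
  fixes i j :: int
  obtains "(j - i) mod 5 = 0" | "(j - i) mod 5 = 1" | "(j - i) mod 5 = 2"
    | "(j - i) mod 5 = 3" | "(j - i) mod 5 = 4"
proof -
  have "(j - i) mod 5 = 0 \<or> (j - i) mod 5 = 1 \<or> (j - i) mod 5 = 2 \<or> (j - i) mod 5 = 3
      \<or> (j - i) mod 5 = 4"
    by presburger
  then show thesis
    by (elim disjE) (fact that)+
qed

lemma mod6_cases: "(j - i) mod 6 \<in> {0, 1, 2, 3, 4, 5}" for i j :: int
proof -
  have "0 \<le> (j - i) mod 6" "(j - i) mod 6 < 6"
    by simp_all
  then show ?thesis
    unfolding insert_iff empty_iff by linarith
qed

lemma mod7_cases: "(j - i) mod 7 \<in> {0, 1, 2, 3, 4, 5, 6}" for i j :: int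
proof -
  have "0 \<le> (j - i) mod 7" "(j - i) mod 7 < 7"
    by simp_all
  then show ?thesis
    unfolding insert_iff empty_iff by linarith
qed

lemma cycle_edges_iff:
  assumes "inj f"
  shows "(f i, f j) \<in> cycle_edges f n \<longleftrightarrow> 1 \<le> i \<and> i \<le> n \<and> j = (if i = n then 1 else Suc i)"
  unfolding cycle_edges_def mem_Collect_eq prod.inject inj_eq[OF assms] by blast

lemma cycle_edges_subset: "cycle_edges f n \<subseteq> f ` {1..n} \<times> f ` {1..n}"
  by (auto simp: cycle_edges_def)

lemma inj_Vv: "inj Vv"
  by (simp add: inj_def)

lemma inj_Vx: "inj Vx"
  by (simp add: inj_def)

lemma cycle_edges_other_label [simp]:
  "(Va i, u) \<notin> cycle_edges Vv n" "(u, Va i) \<notin> cycle_edges Vv n"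
  "(Vy i, u) \<notin> cycle_edges Vv n" "(u, Vy i) \<notin> cycle_edges Vv n"
  "(Vz i, u) \<notin> cycle_edges Vv n" "(u, Vz i) \<notin> cycle_edges Vv n"
  by (auto simp: cycle_edges_def)

text \<open>
  Restricting the edge set before symmetrising keeps the restricted graph in the form that
  the labelling criterion below expects.
\<close>

lemma ugraph_restrict:
  "with_proj (ugraph U E) \<restriction> W = with_proj (ugraph W {e \<in> E. fst e \<in> W \<and> snd e \<in> W})"
  unfolding induce_subgraph_with_proj
  by (auto simp: ugraph_def symcl_def intro!: arg_cong[where f = with_proj])

lemma F12_whole: "F12 \<restriction> (Vx ` {1..11}) = F12"
proof -
  let ?E = "cycle_edges Vx 7 \<union>
      {(Vx 8, Vx 2), (Vx 8, Vx 6), (Vx 9, Vx 3), (Vx 9, Vx 7),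
       (Vx 10, Vx 8), (Vx 10, Vx 9), (Vx 11, Vx 3), (Vx 11, Vx 6)}"
  have "?E \<subseteq> Vx ` {1..11} \<times> Vx ` {1..11}"
    by (simp add: cycle_edges_explicit inj_image_mem_iff[OF inj_Vx])
  then have "{e \<in> ?E. fst e \<in> Vx ` {1..11} \<and> snd e \<in> Vx ` {1..11}} = ?E"
    unfolding set_eq_iff subset_iff mem_Times_iff by blast
  then show ?thesis
    unfolding F12_def ugraph_restrict by (simp only:)
qed

section \<open>Forbidden configurations and cut vertices\<close>

text \<open>
  The situation of the theorem. The first facts translate it into statements about adjacency only:
  girth at least 5, no induced path on seven vertices, an edge across every nontrivial bipartition
  of the vertices, also after deleting one vertex.
\<close>

locale sparse_graph = pair_graph G for G :: "'a pair_pre_digraph" +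
  assumes conn: "connected (with_proj G)"
    and P7_free: "induced_free (with_proj (path_graph 7)) (with_proj G)"
    and C4_free: "induced_free (with_proj (cycle_graph 4)) (with_proj G)"
    and C3_free: "induced_free (with_proj (cycle_graph 3)) (with_proj G)"
    and no_cutset: "\<not> (\<exists>K. clique_cutset (with_proj G) K)"
    and not_complete: "\<not> complete_digraph (card (pverts G)) (with_proj G)"
begin

abbreviation V :: "'a set" where "V \<equiv> pverts G"

abbreviation adj :: "'a \<Rightarrow> 'a \<Rightarrow> bool" (infix "\<sim>" 50)
  where "u \<sim> v \<equiv> (u, v) \<in> parcs G"

lemma adj_commute: "u \<sim> v \<longleftrightarrow> v \<sim> u"
  using pair_sym_arcs by (auto simp: symmetric_def sym_def)

lemma adj_sym: "u \<sim> v \<Longrightarrow> v \<sim> u"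
  using adj_commute by blast

lemma not_adj_sym: "\<not> u \<sim> v \<Longrightarrow> \<not> v \<sim> u"
  using adj_commute by blast

lemma adj_irrefl [simp]: "\<not> u \<sim> u"
  using pair_no_loops by force

text \<open>
  This turns an excluded pattern into a contradiction as soon as a labelling with the right adjacencies
  is found.
\<close>

lemma no_induced_copy:
  assumes "induced_free (with_proj P) (with_proj G)"
    and "parcs P \<subseteq> pverts P \<times> pverts P"
    and "inj_on g (pverts P)" "g ` pverts P \<subseteq> V"
    and "\<forall>u\<in>pverts P. \<forall>v\<in>pverts P. g u \<sim> g v \<longleftrightarrow> (u, v) \<in> parcs P"
  shows False
proof -
  have "digraph_iso (with_proj G \<restriction> (g ` pverts P)) (with_proj P)"
    using assms by (intro induced_copy_iso) auto
  moreover have "induced_subgraph (with_proj G \<restriction> (g ` pverts P)) (with_proj G)"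
    using assms(4) induced_induce by simp
  ultimately show False
    using assms(1) by (auto simp: induced_free_def)
qed

lemma no_triangle:
  assumes "a \<sim> b" "b \<sim> c" "a \<sim> c"
  shows False
proof (rule no_induced_copy[OF C3_free])
  let ?g = "(!) [a, a, b, c]"
  have ne: "a \<noteq> b" "b \<noteq> c" "a \<noteq> c"
    using assms by auto
  have s: "b \<sim> a" "c \<sim> b" "c \<sim> a"
    using assms adj_sym by blast+
  show "parcs (cycle_graph 3) \<subseteq> pverts (cycle_graph 3) \<times> pverts (cycle_graph 3)"
    unfolding cycle_graph_def by (rule ugraph_arcs) (simp add: cycle_edges_explicit)
  show "inj_on ?g (pverts (cycle_graph 3))"
    using ne inj_on_nth_Cons[of "[a, b, c]" 3 a] by (simp add: cycle_graph_def ugraph_def)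
  show "?g ` pverts (cycle_graph 3) \<subseteq> V"
    using assms wellformed' by (auto simp: cycle_graph_def ugraph_def ivl_numeral)
  show "\<forall>u\<in>pverts (cycle_graph 3). \<forall>v\<in>pverts (cycle_graph 3).
      ?g u \<sim> ?g v \<longleftrightarrow> (u, v) \<in> parcs (cycle_graph 3)"
    using assms s by (simp add: cycle_graph_def ugraph_def symcl_def cycle_edges_explicit ivl_numeral)
qed

text \<open>
  Triangle-freeness removes the two possible chords, so every 4-cycle would be induced.
\<close>

lemma no_square:
  assumes "a \<sim> b" "b \<sim> c" "c \<sim> d" "d \<sim> a" "a \<noteq> c" "b \<noteq> d"
  shows False
proof (rule no_induced_copy[OF C4_free])
  let ?g = "(!) [a, a, b, c, d]"
  have s: "b \<sim> a" "c \<sim> b" "d \<sim> c" "a \<sim> d"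
    using assms adj_sym by blast+
  have n: "\<not> a \<sim> c" "\<not> c \<sim> a" "\<not> b \<sim> d" "\<not> d \<sim> b"
    using assms s no_triangle by blast+
  have ne: "distinct [a, b, c, d]"
    using assms s by auto
  show "parcs (cycle_graph 4) \<subseteq> pverts (cycle_graph 4) \<times> pverts (cycle_graph 4)"
    unfolding cycle_graph_def by (rule ugraph_arcs) (simp add: cycle_edges_explicit)
  show "inj_on ?g (pverts (cycle_graph 4))"
    using ne inj_on_nth_Cons[of "[a, b, c, d]" 4 a] by (simp add: cycle_graph_def ugraph_def)
  show "?g ` pverts (cycle_graph 4) \<subseteq> V"
    using assms wellformed' by (auto simp: cycle_graph_def ugraph_def ivl_numeral)
  show "\<forall>u\<in>pverts (cycle_graph 4). \<forall>v\<in>pverts (cycle_graph 4).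
      ?g u \<sim> ?g v \<longleftrightarrow> (u, v) \<in> parcs (cycle_graph 4)"
    using assms(1-4) s n by (simp add: cycle_graph_def ugraph_def symcl_def cycle_edges_explicit ivl_numeral)
qed

text \<open>
  Distinctness of the seven vertices follows from the adjacencies and non-adjacencies.
\<close>

lemma no_path7:
  assumes e: "a \<sim> b" "b \<sim> c" "c \<sim> d" "d \<sim> e" "e \<sim> f" "f \<sim> g"
    and n: "\<not> a \<sim> c" "\<not> a \<sim> d" "\<not> a \<sim> e" "\<not> a \<sim> f" "\<not> a \<sim> g"
      "\<not> b \<sim> d" "\<not> b \<sim> e" "\<not> b \<sim> f" "\<not> b \<sim> g"
      "\<not> c \<sim> e" "\<not> c \<sim> f" "\<not> c \<sim> g" "\<not> d \<sim> f" "\<not> d \<sim> g" "\<not> e \<sim> g"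
  shows False
proof (rule no_induced_copy[OF P7_free])
  let ?g = "(!) [a, a, b, c, d, e, f, g]"
  note s = e n e[THEN adj_sym] n[THEN not_adj_sym]
  have "distinct [a, b, c, d, e, f, g]"
    using s by auto
  then show "inj_on ?g (pverts (path_graph 7))"
    using inj_on_nth_Cons[of "[a, b, c, d, e, f, g]" 7 a] by (simp add: path_graph_def ugraph_def)
  show "parcs (path_graph 7) \<subseteq> pverts (path_graph 7) \<times> pverts (path_graph 7)"
    unfolding path_graph_def by (rule ugraph_arcs) auto
  show "?g ` pverts (path_graph 7) \<subseteq> V"
    using e[THEN in_arcsD1] e[THEN in_arcsD2] by (simp add: path_graph_def ugraph_def ivl_numeral)
  show "\<forall>u\<in>pverts (path_graph 7). \<forall>v\<in>pverts (path_graph 7).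
      ?g u \<sim> ?g v \<longleftrightarrow> (u, v) \<in> parcs (path_graph 7)"
    by (simp add: s path_graph_7 ugraph_def symcl_def ivl_numeral)
qed

lemma strongly_connected_G: "strongly_connected (with_proj G)"
  using symmetric_connected_imp_strongly_connected pair_sym_arcs conn by simp

lemma crossing_edge:
  assumes "Q \<subseteq> V" "Q \<noteq> {}" "Q \<noteq> V"
  shows "\<exists>u\<in>Q. \<exists>v\<in>V - Q. u \<sim> v"
proof (rule ccontr)
  assume none: "\<not> ?thesis"
  obtain a b where ab: "a \<in> Q" "b \<in> V" "b \<notin> Q"
    using assms by blast
  have "a \<rightarrow>\<^sup>*\<^bsub>with_proj G\<^esub> b"
    using strongly_connected_G ab assms by (auto simp: strongly_connected_def)
  then have "b \<in> Q"
  proof (induction rule: reachable_induct)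
    case base
    show ?case by (rule ab(1))
  next
    case (step x y)
    then show ?case
      using none in_arcsD2 by blast
  qed
  then show False using ab by simp
qed

text \<open>
  Otherwise \<open>{x}\<close> would be a clique cutset: it is a clique, and removing it leaves at least two components
  of a graph that has only one.
\<close>

lemma crossing_edge_avoiding:
  assumes x: "x \<in> V" and Q: "Q \<subseteq> V - {x}" "Q \<noteq> {}" "Q \<noteq> V - {x}"
  shows "\<exists>u\<in>Q. \<exists>v\<in>V - {x} - Q. u \<sim> v"
proof (rule ccontr)
  assume none: "\<not> ?thesis"
  let ?H = "with_proj G \<restriction> (V - {x})"
  have sub: "induced_subgraph ?H (with_proj G)"
    using induced_induce by (simp add: Diff_subset)
  have ends: "arcs_ends ?H = {e \<in> parcs G. fst e \<in> V - {x} \<and> snd e \<in> V - {x}}"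
    by (auto simp: arcs_ends_conv)
  have "fin_digraph ?H"
    using finite_arcs finite_verts by (intro wf_digraph.fin_digraphI wellformed_induce_subgraph) auto
  moreover have "sym_digraph ?H"
    using sub induced_graph_imp_graph by blast
  ultimately have "1 < card (pre_digraph.sccs ?H)"
    by (rule card_sccs_disconnected[where Q = Q]) (use Q none in \<open>auto simp: ends\<close>)
  moreover have "card sccs = 1"
    using strongly_connected_G strongly_connected_eq_iff by simp
  ultimately have "clique_cutset (with_proj G) {x}"
    using x by (simp add: clique_cutset_def clique_def)
  then show False
    using no_cutset by blast
qed

text \<open>
  Minimum degree at least two. Connectedness excludes isolated vertices. A vertex with a single neighbour \<open>w\<close> would be cut off by \<open>w\<close>, unless
  these two vertices are the whole graph; but then the graph would be complete.
\<close>

lemma another_neighbour: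
  assumes a: "a \<in> V"
  shows "\<exists>b. a \<sim> b \<and> b \<noteq> w"
proof (rule ccontr)
  assume "\<not> ?thesis"
  then have only: "b = w" if "a \<sim> b" for b
    using that by blast
  have not_K: "\<not> (\<forall>u\<in>V. \<forall>v\<in>V. u \<noteq> v \<longrightarrow> u \<sim> v)"
  proof
    assume "\<forall>u\<in>V. \<forall>v\<in>V. u \<noteq> v \<longrightarrow> u \<sim> v"
    then have "parcs G = {(u, v). (u, v) \<in> V \<times> V \<and> u \<noteq> v}"
      by (auto dest: in_arcsD1 in_arcsD2)
    moreover have "graph (with_proj G)" by unfold_locales
    ultimately show False
      using not_complete by (simp add: complete_digraph_def)
  qed
  then have "V \<noteq> {a}" by auto
  with a crossing_edge[of "{a}"] obtain b where "a \<sim> b" by auto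
  with only have w: "a \<sim> w" by auto
  then have "w \<in> V" "w \<noteq> a"
    using wellformed' by auto
  moreover have "V - {w} \<noteq> {a}"
  proof
    assume "V - {w} = {a}"
    then have "V \<subseteq> {a, w}" by auto
    then show False
      using not_K w adj_sym by blast
  qed
  ultimately obtain v where "a \<sim> v" "v \<noteq> w"
    using crossing_edge_avoiding[of w "{a}"] a by auto
  then show False using only by blast
qed


section \<open>Induced cycles\<close>

text \<open>
  A cycle is a periodic function on the integers, so that rotating it is composition with a
  translation, and all questions about positions become questions about residues modulo the length.
  An induced path on seven vertices lies in every longer induced cycle, and three and four are
  forbidden, which leaves the lengths 5, 6 and 7.
\<close>

definition cyc :: "int \<Rightarrow> (int \<Rightarrow> 'a) \<Rightarrow> bool" where
  "cyc n c \<longleftrightarrow> n \<in> {5, 6, 7} \<and> (\<forall>i j. c i \<sim> c j \<longleftrightarrow> (i - j) mod n \<in> {1, n - 1})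
     \<and> (\<forall>i j. c i = c j \<longleftrightarrow> (i - j) mod n = 0)"

lemma cyc_length: "cyc n c \<Longrightarrow> n = 5 \<or> n = 6 \<or> n = 7"
  by (simp add: cyc_def)

lemma cyc_adj: "cyc n c \<Longrightarrow> c i \<sim> c j \<longleftrightarrow> (i - j) mod n = 1 \<or> (i - j) mod n = n - 1"
  by (simp add: cyc_def)

lemma cyc_eq: "cyc n c \<Longrightarrow> c i = c j \<longleftrightarrow> (i - j) mod n = 0"
  by (simp add: cyc_def)

lemma cyc_shift:
  assumes c: "cyc n c"
  shows "cyc n (\<lambda>i. c (i + k))"
proof -
  have A: "c (i + k) \<sim> c (j + k) \<longleftrightarrow> (i - j) mod n \<in> {1, n - 1}"
    and B: "c (i + k) = c (j + k) \<longleftrightarrow> (i - j) mod n = 0" for i j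
    using cyc_adj[OF c, of "i + k" "j + k"] cyc_eq[OF c, of "i + k" "j + k"]
    by (simp_all only: add_diff_cancel_right insert_iff empty_iff simp_thms)
  have "n \<in> {5, 6, 7}"
    using cyc_length[OF c] by simp
  then show ?thesis
    unfolding cyc_def by (intro conjI allI A B)
qed

lemma range_shift: "range (\<lambda>i::int. c (i + k)) = range c"
proof
  show "range c \<subseteq> range (\<lambda>i. c (i + k))"
  proof
    fix x assume "x \<in> range c"
    then obtain i where "x = c (i - k + k)" by auto
    then show "x \<in> range (\<lambda>i. c (i + k))" by (rule range_eqI)
  qed
qed auto

lemma cyc_add:
  assumes c: "cyc n c" and d: "(j - i) mod n = d"
  shows "c j = c (i + d)"
proof -
  have "j - (i + d) = n * ((j - i) div n)"
    using d by (simp add: minus_mod_eq_mult_div[symmetric])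
  then show ?thesis
    by (simp only: cyc_eq[OF c] mod_mult_self1_is_0)
qed

lemma cyc_in_V: "cyc n c \<Longrightarrow> c i \<in> V"
  using cyc_adj[of n c i "i + 1"] cyc_length[of n c] by (auto intro: in_arcsD1)

text \<open>
  Girth: two neighbours on the cycle at distance 1 or 2 would close a triangle or a 4-cycle.
\<close>

lemma cyc_neighbours_far:
  assumes c: "cyc n c" and x: "x \<notin> range c" "x \<sim> c i" "x \<sim> c j"
  shows "(j - i) mod n \<notin> {1, 2, n - 2, n - 1}"
proof
  let ?d = "(j - i) mod n"
  assume d: "?d \<in> {1, 2, n - 2, n - 1}"
  have j: "c j = c (i + ?d)"
    using cyc_add c by blast
  have adj1: "c k \<sim> c (k + 1)" "c (k + 1) \<sim> c k" for k
    using cyc_adj[OF c] cyc_length[OF c] by auto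
  have n: "c (k + n) = c k" for k
    using cyc_eq[OF c] by simp
  have *: False if "x \<sim> c k" "x \<sim> c (k + 1)" for k
    using no_triangle adj1 that by blast
  have **: False if k: "x \<sim> c k" "x \<sim> c (k + 2)" for k
  proof (rule no_square)
    show "x \<sim> c k" "c k \<sim> c (k + 1)" "c (k + 1) \<sim> c (k + 2)" "c (k + 2) \<sim> x"
      using k adj1[of k] adj1[of "k + 1"] adj_sym by (auto simp: add.assoc)
    show "x \<noteq> c (k + 1)"
      using x by auto
    show "c k \<noteq> c (k + 2)"
      using cyc_eq[OF c] cyc_length[OF c] by auto
  qed
  consider "?d = 1" | "?d = 2" | "?d = n - 2" | "?d = n - 1"
    using d by auto
  then show False
  proof cases
    case 1 then show False using * x j by auto
  next
    case 2 then show False using ** x j by auto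
  next
    case 3
    have "c j = c (i + (n - 2))"
      using j unfolding 3 .
    also have "i + (n - 2) = i - 2 + n"
      by simp
    also have "c (i - 2 + n) = c (i - 2)"
      by (rule n)
    finally have "c j = c (i - 2)" .
    then show False using **[of "i - 2"] x by auto
  next
    case 4
    have "c j = c (i + (n - 1))"
      using j unfolding 4 .
    also have "i + (n - 1) = i - 1 + n"
      by simp
    also have "c (i - 1 + n) = c (i - 1)"
      by (rule n)
    finally have "c j = c (i - 1)" .
    then show False using *[of "i - 1"] x by auto
  qed
qed

lemma cyc_of_list:
  assumes n: "n \<in> {5, 6, 7}" "length xs = nat n" and d: "distinct xs"
    and adj: "\<forall>i<nat n. \<forall>j<nat n. xs ! i \<sim> xs ! j \<longleftrightarrow> (int i - int j) mod n \<in> {1, n - 1}"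
  shows "cyc n (\<lambda>i. xs ! nat (i mod n))"
proof -
  have n0: "n > 0" using n by auto
  have lt: "nat (i mod n) < nat n" for i
    using n0 by simp
  have "xs ! nat (i mod n) \<sim> xs ! nat (j mod n) \<longleftrightarrow> (i - j) mod n \<in> {1, n - 1}" for i j
    using adj lt[of i] lt[of j] n0 by (simp add: mod_diff_eq)
  moreover have "xs ! nat (i mod n) = xs ! nat (j mod n) \<longleftrightarrow> (i - j) mod n = 0" for i j
    using lt[of i] lt[of j] n0 d n(2)
    by (simp add: nth_eq_iff_index_eq eq_nat_nat_iff mod_eq_dvd_iff dvd_eq_mod_eq_0)
  ultimately show ?thesis
    using n by (simp add: cyc_def)
qed

lemma cyc5_of_edges:
  assumes e: "a \<sim> b" "b \<sim> c" "c \<sim> d" "d \<sim> e" "e \<sim> a"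
  shows "\<exists>f. cyc 5 f"
proof -
  have n: "\<not> a \<sim> c" "\<not> b \<sim> d" "\<not> c \<sim> e" "\<not> d \<sim> a" "\<not> e \<sim> b"
    using e no_triangle adj_sym by blast+
  note s = e n e[THEN adj_sym] n[THEN not_adj_sym]
  have "distinct [a, b, c, d, e]"
    using s by auto
  then have "cyc 5 (\<lambda>i. [a, b, c, d, e] ! nat (i mod 5))"
    by (intro cyc_of_list) (simp_all add: s numeral_eq_Suc All_less_Suc)
  then show ?thesis by blast
qed

lemma cyc6_of_edges:
  assumes e: "a \<sim> b" "b \<sim> c" "c \<sim> d" "d \<sim> e" "e \<sim> f" "f \<sim> a"
    and d: "a \<noteq> c" "b \<noteq> d" "c \<noteq> e" "d \<noteq> f" "e \<noteq> a" "f \<noteq> b"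
  shows "\<exists>f. cyc 6 f"
proof -
  have n: "\<not> a \<sim> c" "\<not> b \<sim> d" "\<not> c \<sim> e" "\<not> d \<sim> f" "\<not> e \<sim> a" "\<not> f \<sim> b"
    using e no_triangle adj_sym by blast+
  have n': "\<not> a \<sim> d" "\<not> b \<sim> e" "\<not> c \<sim> f"
    using e d no_square[of a b c d] no_square[of b c d e] no_square[of c d e f]
      adj_commute[of a d] adj_commute[of b e] adj_commute[of c f] by auto
  note s = e n n' e[THEN adj_sym] n[THEN not_adj_sym] n'[THEN not_adj_sym]
  have "distinct [a, b, c, d, e, f]"
    using s d by auto
  then have "cyc 6 (\<lambda>i. [a, b, c, d, e, f] ! nat (i mod 6))"
    by (intro cyc_of_list) (simp_all add: s numeral_eq_Suc All_less_Suc)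
  then show ?thesis by blast
qed

text \<open>
  The hypotheses are those of \<open>no_path7\<close>, except that here the two ends are adjacent, so that a
  case distinction combines the two lemmas.
\<close>

lemma cyc7_of_edges:
  assumes e: "a \<sim> b" "b \<sim> c" "c \<sim> d" "d \<sim> e" "e \<sim> f" "f \<sim> g" "a \<sim> g"
    and n: "\<not> a \<sim> c" "\<not> a \<sim> d" "\<not> a \<sim> e" "\<not> a \<sim> f"
      "\<not> b \<sim> d" "\<not> b \<sim> e" "\<not> b \<sim> f" "\<not> b \<sim> g"
      "\<not> c \<sim> e" "\<not> c \<sim> f" "\<not> c \<sim> g" "\<not> d \<sim> f" "\<not> d \<sim> g" "\<not> e \<sim> g"
  shows "\<exists>f. cyc 7 f"
proof -
  note s = e n e[THEN adj_sym] n[THEN not_adj_sym]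
  have "distinct [a, b, c, d, e, f, g]"
    using s by auto
  then have "cyc 7 (\<lambda>i. [a, b, c, d, e, f, g] ! nat (i mod 7))"
    by (intro cyc_of_list) (simp_all add: s numeral_eq_Suc All_less_Suc)
  then show ?thesis by blast
qed

text \<open>
  This is the form in which the structure around a 5-cycle is analysed.
\<close>

lemma no_path7_or_cyc7:
  assumes no7: "\<not> (\<exists>f. cyc 7 f)"
    and e: "a \<sim> b" "b \<sim> c" "c \<sim> d" "d \<sim> e" "e \<sim> f" "f \<sim> g"
    and n: "\<not> a \<sim> c" "\<not> a \<sim> d" "\<not> a \<sim> e" "\<not> a \<sim> f"
      "\<not> b \<sim> d" "\<not> b \<sim> e" "\<not> b \<sim> f" "\<not> b \<sim> g"
      "\<not> c \<sim> e" "\<not> c \<sim> f" "\<not> c \<sim> g" "\<not> d \<sim> f" "\<not> d \<sim> g" "\<not> e \<sim> g"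
  shows False
proof (cases "a \<sim> g")
  case True
  show False using cyc7_of_edges[OF e True n] no7 by blast
next
  case False
  show False using no_path7[OF e n(1-4) False n(5-)] .
qed

text \<open>
  Walk through the graph without turning back, which minimum degree two permits. Its first seven vertices
  do not induce a path, so two of them that are not consecutive are adjacent. An adjacency of this
  kind that spans the shortest stretch of the walk closes an induced cycle, of length 5, 6 or 7.
\<close>

lemma ex_cyc: "\<exists>n f. cyc n f"
proof (rule ccontr)
  assume none: "\<not> ?thesis"
  have no5: False if "p \<sim> q" "q \<sim> r" "r \<sim> s" "s \<sim> t" "t \<sim> p" for p q r s t
    using cyc5_of_edges[OF that] none by blast
  have no7: "\<not> (\<exists>f. cyc 7 f)"
    using none by blast
  have step: "\<exists>q. p \<sim> q \<and> q \<noteq> w" if "w \<sim> p" for p w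
    using another_neighbour[of p w] in_arcsD2 that by blast
  obtain a where "a \<in> V"
    using strongly_connected_G by (auto simp: strongly_connected_def)
  then obtain b where b: "a \<sim> b"
    using another_neighbour by blast
  obtain c where c: "b \<sim> c" "c \<noteq> a" using step[OF b] by blast
  obtain d where d: "c \<sim> d" "d \<noteq> b" using step[OF c(1)] by blast
  obtain e where e: "d \<sim> e" "e \<noteq> c" using step[OF d(1)] by blast
  obtain f where f: "e \<sim> f" "f \<noteq> d" using step[OF e(1)] by blast
  obtain g where g: "f \<sim> g" "g \<noteq> e" using step[OF f(1)] by blast
  \<comment> \<open>The next four facts exclude chords between vertices at distance 2, 3, 4 and 5 of the walk.\<close>
  have t: "\<not> p \<sim> r" if "p \<sim> q" "q \<sim> r" for p q r
    using no_triangle that by blast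
  have s: "\<not> p \<sim> r" if "p \<sim> q" "q \<sim> t" "t \<sim> r" "t \<noteq> p" "r \<noteq> q" for p q r t
    using no_square[of p q t r] adj_sym that by blast
  have v: "\<not> p \<sim> r" if "p \<sim> q" "q \<sim> t" "t \<sim> u" "u \<sim> r" for p q r t u
    using no5[of p q t u r] adj_sym that by blast
  have vi: "\<not> p \<sim> r" if "p \<sim> q" "q \<sim> t" "t \<sim> u" "u \<sim> w" "w \<sim> r"
    "t \<noteq> p" "u \<noteq> q" "w \<noteq> t" "r \<noteq> u" for p q r t u w
  proof
    assume "p \<sim> r"
    moreover have "w \<noteq> p" "r \<noteq> q"
      using no_square[of p q t u] no_square[of q t u w] that adj_sym by blast+
    ultimately show False
      using cyc6_of_edges[of p q t u w r] none adj_sym that by blast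
  qed
  note e7 = b c(1) d(1) e(1) f(1) g(1)
  note two = t[OF b c(1)] t[OF c(1) d(1)] t[OF d(1) e(1)] t[OF e(1) f(1)] t[OF f(1) g(1)]
  note three = s[OF b c(1) d(1) c(2) d(2)] s[OF c(1) d(1) e(1) d(2) e(2)]
    s[OF d(1) e(1) f(1) e(2) f(2)] s[OF e(1) f(1) g(1) f(2) g(2)]
  note four = v[OF b c(1) d(1) e(1)] v[OF c(1) d(1) e(1) f(1)] v[OF d(1) e(1) f(1) g(1)]
  note five = vi[OF b c(1) d(1) e(1) f(1) c(2) d(2) e(2) f(2)]
    vi[OF c(1) d(1) e(1) f(1) g(1) d(2) e(2) f(2) g(2)]
  show False
    by (rule no_path7_or_cyc7[OF no7 e7]) (fact two three four five)+
qed


section \<open>Recognising a graph from a spanning labelling\<close>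

text \<open>
  The criterion by which every member of the family is recognised: \<open>g\<close> names the vertices of \<open>G\<close> by the
  labels of the pattern.
\<close>

lemma iso_ugraph:
  assumes E: "E \<subseteq> U \<times> U" and g: "inj_on g U" "g ` U = V"
    and adj: "\<And>u v. u \<in> U \<Longrightarrow> v \<in> U \<Longrightarrow> g u \<sim> g v \<longleftrightarrow> (u, v) \<in> E \<or> (v, u) \<in> E"
  shows "digraph_iso (with_proj G) (with_proj (ugraph U E))"
proof -
  have "with_proj G \<restriction> V = with_proj G"
    using wellformed' by (auto simp: induce_subgraph_def with_proj_def)
  moreover have "digraph_iso (with_proj G \<restriction> (g ` pverts (ugraph U E))) (with_proj (ugraph U E))"
    by (rule induced_copy_iso[OF ugraph_arcs[OF E]]) (use g adj in \<open>auto simp: ugraph_def symcl_def\<close>)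
  ultimately show ?thesis
    using g by (simp add: ugraph_def)
qed

lemma cyc_cycle_edges:
  assumes c: "cyc (int n) c" and f: "inj f" and ij: "i \<in> {1..n}" "j \<in> {1..n}"
  shows "c (int i) \<sim> c (int j) \<longleftrightarrow> (f i, f j) \<in> cycle_edges f n \<or> (f j, f i) \<in> cycle_edges f n"
proof -
  have n: "n = 5 \<or> n = 6 \<or> n = 7"
    using cyc_length[OF c] by auto
  have "\<forall>i\<in>{1..n}. \<forall>j\<in>{1..n}. c (int i) \<sim> c (int j) \<longleftrightarrow>
      j = (if i = n then 1 else Suc i) \<or> i = (if j = n then 1 else Suc j)"
    using n by (elim disjE) (simp_all add: cyc_adj[OF c] ivl_numeral)
  then show ?thesis
    using ij by (simp add: cycle_edges_iff[OF f])
qed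

lemma cyc_inj_on:
  assumes c: "cyc (int n) c"
  shows "inj_on (\<lambda>i. c (int i)) {1..n}"
proof (rule inj_onI)
  fix i j assume ij: "i \<in> {1..n}" "j \<in> {1..n}" and "c (int i) = c (int j)"
  then have "(int i - int j) mod int n = 0"
    unfolding cyc_eq[OF c] by simp
  then show "i = j"
    by (rule nat_mod_eq_imp_eq[OF _ ij])
qed

lemma cyc_range: 
  assumes c: "cyc (int n) c"
  shows "range c = (\<lambda>i. c (int i)) ` {1..n}"
proof
  have n: "n > 0" using cyc_length[OF c] by auto
  show "range c \<subseteq> (\<lambda>i. c (int i)) ` {1..n}"
  proof
    fix x assume "x \<in> range c"
    then obtain i where "x = c i" by auto
    define j where "j = nat ((i - 1) mod int n) + 1"
    have j: "int j = (i - 1) mod int n + 1" "j \<in> {1..n}"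
      using n by (auto simp: j_def nat_less_iff Suc_le_eq)
    have "i - int j = int n * ((i - 1) div int n)"
      using j(1) minus_mod_eq_mult_div[of "i - 1" "int n"] by simp
    then have "c i = c (int j)"
      by (simp only: cyc_eq[OF c] mod_mult_self1_is_0)
    then show "x \<in> (\<lambda>i. c (int i)) ` {1..n}"
      using j(2) \<open>x = c i\<close> by blast
  qed
qed auto

text \<open>
  The vertices attached at \<open>i\<close> form the set that is often written \<open>A\<^sub>i\<close>. For cycles of length 5, and
  for cycles of length 6 in the absence of 5-cycles, an outside vertex is attached at most at one
  position.
\<close>

definition attached :: "(int \<Rightarrow> 'a) \<Rightarrow> int \<Rightarrow> 'a \<Rightarrow> bool" where
  "attached c i x \<longleftrightarrow> x \<notin> range c \<and> x \<sim> c i"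

lemma attached_shift: "attached (\<lambda>j. c (j + k)) i x \<longleftrightarrow> attached c (i + k) x"
  by (simp add: attached_def range_shift)

lemma attached_cong: "cyc n c \<Longrightarrow> attached c i x \<Longrightarrow> (j - i) mod n = 0 \<Longrightarrow> attached c j x"
  using cyc_add[of n c j i 0] by (simp add: attached_def)

lemma attached_neq: "attached c i x \<Longrightarrow> x \<noteq> c j"
  by (auto simp: attached_def)

lemma attached_in_V: "attached c i x \<Longrightarrow> x \<in> V"
  by (auto simp: attached_def dest: in_arcsD1)

lemma attached_same_nonadj: 
  assumes "attached c i x" "attached c i y" shows "\<not> x \<sim> y"
  using assms no_triangle[of x y "c i"] by (auto simp: attached_def)

text \<open>
  Two vertices attached at the same position with a further common neighbour would lie on a 4-cycle.
\<close>

lemma attached_unique: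
  assumes "attached c i x" "attached c i y" "x \<sim> z" "z \<sim> y" "z \<noteq> c i"
  shows "x = y"
  using assms no_square[of "c i" x z y] adj_sym by (auto simp: attached_def)


section \<open>Structure around a 5-cycle in the absence of 7-cycles\<close>

context
  fixes c
  assumes c: "cyc 5 c" and no7: "\<not> (\<exists>f. cyc 7 f)"
begin

lemma attached5_adj_iff: "attached c i x \<Longrightarrow> x \<sim> c j \<longleftrightarrow> (j - i) mod 5 = 0"
proof
  assume x: "attached c i x" "x \<sim> c j"
  then have "(j - i) mod 5 \<notin> {1, 2, 3, 4}"
    using cyc_neighbours_far[OF c, of x i j] by (auto simp: attached_def)
  moreover have "(j - i) mod 5 \<in> {0..<5}"
    by simp
  ultimately show "(j - i) mod 5 = 0"
    by auto
next
  assume "attached c i x" "(j - i) mod 5 = 0"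
  then have "attached c j x"
    by (rule attached_cong[OF c])
  then show "x \<sim> c j"
    by (simp add: attached_def)
qed

lemma adj_attached5_iff: "attached c i x \<Longrightarrow> c j \<sim> x \<longleftrightarrow> (j - i) mod 5 = 0"
  using attached5_adj_iff[of i x j] adj_commute[of "c j" x] by simp

lemma attached5_index_unique: "attached c i x \<Longrightarrow> attached c j x \<Longrightarrow> (j - i) mod 5 = 0"
  using attached5_adj_iff[of i x j] by (simp add: attached_def)

lemma attached_consecutive_nonadj:
  assumes "attached c i x" "attached c (i + 1) y"
  shows "\<not> x \<sim> y"
proof
  assume "x \<sim> y"
  moreover have "c i \<sim> c (i + 1)"
    by (simp add: cyc_adj[OF c])
  ultimately show False
    using no_square[of x "c i" "c (i + 1)" y] assms adj_sym by (auto simp: attached_def)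
qed

lemma attached5_nonadj:
  assumes "attached c i x" "attached c j y" "(j - i) mod 5 = 0 \<or> (j - i) mod 5 = 1 \<or> (j - i) mod 5 = 4"
  shows "\<not> x \<sim> y"
  using assms(3)
proof (elim disjE)
  assume "(j - i) mod 5 = 0"
  then have "attached c j x" by (rule attached_cong[OF c assms(1)])
  then show ?thesis using attached_same_nonadj assms by blast
next
  assume "(j - i) mod 5 = 1"
  then have "(i + 1 - j) mod 5 = 0" by presburger
  then have "attached c (i + 1) y" by (rule attached_cong[OF c assms(2)])
  then show ?thesis using attached_consecutive_nonadj assms by blast
next
  assume "(j - i) mod 5 = 4"
  then have "(j + 1 - i) mod 5 = 0" by presburger
  then have "attached c (j + 1) x" by (rule attached_cong[OF c assms(1)])
  then show ?thesis using attached_consecutive_nonadj[of j y x] assms not_adj_sym by blast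
qed

text \<open>
  Adjacent attached vertices sit at positions at distance 2. Since 2 generates the residues modulo 5, a
  chain of links runs through the positions in the order \<open>i, i + 2, i + 4, i + 6, i + 8\<close>, along the
  inner pentagram of the Petersen graph.
\<close>

definition link :: "int \<Rightarrow> 'a \<Rightarrow> 'a \<Rightarrow> bool" where
  "link i x y \<longleftrightarrow> attached c i x \<and> attached c (i + 2) y \<and> x \<sim> y"

text \<open>
  Otherwise \<open>y, x, c i, c (i + 1), x', y', c (i + 3)\<close> is an induced path.
\<close>

lemma links_consecutive:
  assumes "link i x y" "link (i + 1) x' y'"
  shows "x \<sim> y'"
proof (rule ccontr)
  assume n: "\<not> x \<sim> y'"
  have a: "attached c i x" "attached c (i + 2) y" "attached c (i + 1) x'" "attached c (i + 3) y'"
    and e: "x \<sim> y" "x' \<sim> y'"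
    using assms by (auto simp: link_def add.assoc)
  note r = attached5_adj_iff[OF a(1)] attached5_adj_iff[OF a(2)] attached5_adj_iff[OF a(3)] attached5_adj_iff[OF a(4)]
    adj_attached5_iff[OF a(1)] adj_attached5_iff[OF a(2)] adj_attached5_iff[OF a(3)] adj_attached5_iff[OF a(4)] cyc_adj[OF c]
  have "\<not> y \<sim> x'" "\<not> y \<sim> y'" "\<not> x \<sim> x'"
    by (rule attached5_nonadj[OF a(2) a(3)] attached5_nonadj[OF a(2) a(4)] attached5_nonadj[OF a(1) a(3)]; simp)+
  then show False
    using no_path7[of y x "c i" "c (i + 1)" x' y' "c (i + 3)"] n e adj_sym by (simp add: r)
qed

text \<open>
  Otherwise \<open>x, y, c (i + 2), x', y', c (i + 4), c i\<close> is an induced 7-cycle.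
\<close>

lemma links_share_end:
  assumes "link i x y" "link (i + 2) x' y'"
  shows "y = x'"
proof (rule ccontr)
  assume ne: "y \<noteq> x'"
  have a: "attached c i x" "attached c (i + 2) y" "attached c (i + 2) x'" "attached c (i + 4) y'"
    and e: "x \<sim> y" "x' \<sim> y'"
    using assms by (auto simp: link_def add.assoc)
  note r = attached5_adj_iff[OF a(1)] attached5_adj_iff[OF a(2)] attached5_adj_iff[OF a(3)] attached5_adj_iff[OF a(4)]
    adj_attached5_iff[OF a(1)] adj_attached5_iff[OF a(2)] adj_attached5_iff[OF a(3)] adj_attached5_iff[OF a(4)] cyc_adj[OF c]
  have "\<not> y \<sim> x'" "\<not> x \<sim> y'"
    by (rule attached5_nonadj[OF a(2) a(3)] attached5_nonadj[OF a(1) a(4)]; simp)+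
  moreover have "\<not> x \<sim> x'" "\<not> y \<sim> y'"
    using attached_unique[OF a(2,3)] ne attached_neq[OF a(1)] attached_neq[OF a(4)] e adj_sym by blast+
  ultimately show False
    using no_path7_or_cyc7[OF no7, of x y "c (i + 2)" x' y' "c (i + 4)" "c i"] e
    by (simp add: r)
qed

text \<open>
  For a vertex \<open>y\<close> at distance 2 from the cycle with two attached neighbours: positions that differ by 1
  give an induced path that goes from \<open>x\<close> over \<open>y\<close> to \<open>z\<close> and then around the cycle up to the last
  vertex before \<open>c i\<close>; positions that differ by 2 give an induced 7-cycle through \<open>y\<close> and the long arc.
\<close>

lemma second_neighbour_index_diff:
  assumes y: "y \<notin> range c" "\<And>j. \<not> y \<sim> c j" and e: "x \<sim> y" "y \<sim> z"
    and a: "attached c i x" "attached c j z"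
  shows "(j - i) mod 5 \<noteq> 1 \<and> (j - i) mod 5 \<noteq> 2"
proof (rule ccontr)
  note y' = y(2) y(2)[THEN not_adj_sym]
  assume "\<not> ?thesis"
  then have "(i + 1 - j) mod 5 = 0 \<or> (i + 2 - j) mod 5 = 0"
    by presburger
  then have "attached c (i + 1) z \<or> attached c (i + 2) z"
    using attached_cong[OF c a(2)] by metis
  moreover have n: "\<not> x \<sim> z"
    using no_triangle e by blast
  note x = attached5_adj_iff[OF a(1)] adj_attached5_iff[OF a(1)] cyc_adj[OF c]
  have False if z: "attached c (i + 1) z"
    using no_path7[of x y z "c (i + 1)" "c (i + 2)" "c (i + 3)" "c (i + 4)"] n e
    by (simp add: x y' attached5_adj_iff[OF z] adj_attached5_iff[OF z])
  moreover have False if z: "attached c (i + 2) z"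
    using no_path7_or_cyc7[OF no7, of z y x "c i" "c (i + 4)" "c (i + 3)" "c (i + 2)"]
      n[THEN not_adj_sym] e adj_sym
    by (simp add: x y' attached5_adj_iff[OF z] adj_attached5_iff[OF z])
  ultimately show False
    by blast
qed

text \<open>
  A vertex \<open>y\<close> at distance 2 from the cycle has two neighbours. If both are attached, their positions
  agree (a 4-cycle) or differ by 1 or 2 (excluded above). If one is not, it starts an
  induced path that enters the cycle through the other neighbour and continues for four vertices.
\<close>

lemma C5_dominates:
  assumes "z \<in> V"
  shows "z \<in> range c \<or> (\<exists>i. attached c i z)"
proof (rule ccontr)
  assume z: "\<not> (z \<in> range c \<or> (\<exists>i. attached c i z))"
  let ?U = "{z \<in> V. z \<in> range c \<or> (\<exists>i. attached c i z)}"
  have "c 0 \<in> ?U"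
    using cyc_in_V[OF c] by simp
  then have "?U \<subseteq> V" "?U \<noteq> {}" "?U \<noteq> V"
    using assms z by blast+
  from crossing_edge[OF this] obtain x y
    where x: "x \<in> ?U" and y: "y \<in> V" "y \<notin> ?U" "x \<sim> y"
    by blast
  have y': "y \<notin> range c" "\<not> y \<sim> c j" for j
    using y by (auto simp: attached_def)
  obtain i where i: "attached c i x"
    using x y' y(3) adj_sym by blast
  obtain z where z: "y \<sim> z" "z \<noteq> x"
    using another_neighbour y(1) by blast
  show False
  proof (cases "\<exists>j. attached c j z")
    case True
    then obtain j where j: "attached c j z" by blast
    have "(j - i) mod 5 \<noteq> 1 \<and> (j - i) mod 5 \<noteq> 2"
      by (rule second_neighbour_index_diff[OF y' y(3) z(1) i j])
    moreover have "(i - j) mod 5 \<noteq> 1 \<and> (i - j) mod 5 \<noteq> 2"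
      by (rule second_neighbour_index_diff[OF y' z(1)[THEN adj_sym] y(3)[THEN adj_sym] j i])
    ultimately have "(i - j) mod 5 = 0"
      by presburger
    then have "attached c i z"
      by (rule attached_cong[OF c j])
    then show False
      using attached_unique[OF i, of z y] y y' z by auto
  next
    case False
    have "z \<notin> range c"
      using z y' by auto
    then have z': "\<not> z \<sim> c j" for j
      using False by (auto simp: attached_def)
    have "\<not> z \<sim> x"
      using no_triangle y z adj_sym by blast
    moreover have "z \<sim> y" "y \<sim> x" using z y adj_sym by blast+
    ultimately show False
      using no_path7[of z y x "c i" "c (i + 1)" "c (i + 2)" "c (i + 3)"] 
      by (simp add: z' y' attached5_adj_iff[OF i] cyc_adj[OF c])
  qed
qed

text \<open>
  The second neighbour of an attached vertex is attached too, at distance 2.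
\<close>

lemma attached5_linked:
  assumes "attached c i x"
  shows "(\<exists>y. link i x y) \<or> (\<exists>y. link (i - 2) y x)"
proof -
  obtain y where y: "x \<sim> y" "y \<noteq> c i"
    using another_neighbour attached_in_V[OF assms] by blast
  have "y \<notin> range c"
  proof
    assume "y \<in> range c"
    then obtain j where "y = c j" by auto
    then show False
      using y attached5_adj_iff[OF assms, of j] cyc_eq[OF c, of j i] by simp
  qed
  then obtain j where j: "attached c j y"
    using C5_dominates y in_arcsD2 by blast
  show ?thesis
  proof (cases rule: mod5_cases[of j i])
    case 3
    then have "(i + 2 - j) mod 5 = 0" by presburger
    then have "link i x y"
      using assms y attached_cong[OF c j] by (simp add: link_def)
    then show ?thesis by blast
  next
    case 4
    then have "(i - 2 - j) mod 5 = 0" by presburger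
    then have "link (i - 2) y x"
      using assms y attached_cong[OF c j] adj_sym by (simp add: link_def)
    then show ?thesis by blast
  qed (use attached5_nonadj[OF assms j] y in auto)
qed

lemma link_cong: "link i x y \<Longrightarrow> (j - i) mod 5 = 0 \<Longrightarrow> link j x y"
  using attached_cong[OF c, of i x j] attached_cong[OF c, of "i + 2" y "j + 2"] by (simp add: link_def)

lemma link_right_unique: "link i x y \<Longrightarrow> link i x y' \<Longrightarrow> y = y'"
  using attached_unique[of c "i + 2" y y' x] attached_neq adj_sym unfolding link_def by blast

lemma link_left_unique: "link i x y \<Longrightarrow> link i x' y \<Longrightarrow> x = x'"
  using attached_unique[of c i x x' y] attached_neq adj_sym unfolding link_def by blast

end


section \<open>The shapes F1 to F5 and F0'\<close>

lemma attached_index_in_range: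
  assumes c: "cyc (int n) c" and i: "attached c i x"
  shows "\<exists>k\<in>{1..n}. attached c (int k) x"
proof -
  have "c i \<in> (\<lambda>k. c (int k)) ` {1..n}"
    using cyc_range[OF c] by blast
  then obtain k where k: "k \<in> {1..n}" "c i = c (int k)"
    by blast
  then show ?thesis
    using i by (auto simp: attached_def intro!: bexI[of _ k])
qed

text \<open>
  The common shape of \<open>F1\<close>, \<open>F3\<close>, \<open>F4\<close> and \<open>F5\<close>: at each position in \<open>S\<close> exactly one vertex \<open>a i\<close> is
  attached, and \<open>R\<close> lists the links. Positions that are equal or consecutive cannot be linked, which is why
  \<open>R\<close> has to be complete only for differences 2 and 3.
\<close>

lemma iso_spoked:
  assumes c: "cyc 5 c" and no7: "\<not> (\<exists>f. cyc 7 f)"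
    and S: "S \<subseteq> {1..5}" and a: "\<And>i. i \<in> S \<Longrightarrow> attached c (int i) (a i)"
    and only: "\<And>i u. i \<in> {1..5} \<Longrightarrow> attached c (int i) u \<Longrightarrow> i \<in> S \<and> u = a i"
    and R: "R \<subseteq> S \<times> S" "\<And>i j. (i, j) \<in> R \<Longrightarrow> a i \<sim> a j"
    and R': "\<And>i j. i \<in> S \<Longrightarrow> j \<in> S \<Longrightarrow> (int j - int i) mod 5 \<in> {2, 3} \<Longrightarrow> (i, j) \<in> R \<or> (j, i) \<in> R"
  shows "digraph_iso (with_proj G) (with_proj (ugraph (Vv ` {1..5} \<union> Va ` S)
    (cycle_edges Vv 5 \<union> {(Va i, Vv i) | i. i \<in> S} \<union> (\<lambda>(i, j). (Va i, Va j)) ` R)))"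
proof -
  define g where "g l = (case l of Vv i \<Rightarrow> c (int i) | Va i \<Rightarrow> a i | _ \<Rightarrow> c 0)" for l
  have g: "g (Vv i) = c (int i)" "g (Va i) = a i" for i
    by (simp_all add: g_def)
  have c5: "cyc (int 5) c" using c by simp
  have eq: "i = j" if "i \<in> S" "j \<in> S" "(int i - int j) mod 5 = 0" for i j
    using nat_mod_eq_imp_eq[of i j 5] subsetD[OF S that(1)] subsetD[OF S that(2)] that(3) by simp
  have aa: "a i \<sim> a j \<longleftrightarrow> (i, j) \<in> R \<or> (j, i) \<in> R" if ij: "i \<in> S" "j \<in> S" for i j
  proof
    assume "a i \<sim> a j"
    then have "(int j - int i) mod 5 \<in> {2, 3}"
      using attached5_nonadj[OF c no7 a[OF ij(1)] a[OF ij(2)]]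
        mod5_cases[of "int j" "int i" "(int j - int i) mod 5 \<in> {2, 3}"] by auto
    then show "(i, j) \<in> R \<or> (j, i) \<in> R"
      using R' ij by blast
  next
    assume "(i, j) \<in> R \<or> (j, i) \<in> R"
    then show "a i \<sim> a j"
      using R(2) adj_sym by blast
  qed
  have ca: "c (int i) \<sim> a j \<longleftrightarrow> i = j" "a j \<sim> c (int i) \<longleftrightarrow> i = j" if "i \<in> {1..5}" "j \<in> S" for i j
    using attached5_adj_iff[OF c no7 a, of j "int i"] adj_attached5_iff[OF c no7 a, of j "int i"]
      nat_mod_eq_imp_eq[of i j 5] that subsetD[OF S that(2)] by auto
  have "inj_on g (Vv ` {1..5} \<union> Va ` S)"
  proof -
    have "c (int i) = c (int j) \<longleftrightarrow> i = j" if "i \<in> {1..5}" "j \<in> {1..5}" for i j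
      using inj_on_eq_iff[OF cyc_inj_on[OF c5] that] .
    moreover have "a i = a j \<longleftrightarrow> i = j" if ij: "i \<in> S" "j \<in> S" for i j
    proof
      assume "a i = a j"
      then have "(int i - int j) mod 5 = 0"
        using attached5_index_unique[OF c no7 a[OF ij(2)], of "int i"] a[OF ij(1)] by simp
      then show "i = j"
        by (rule eq[OF ij])
    qed simp
    moreover have "a j \<noteq> c (int i)" if "j \<in> S" for i j
      using attached_neq[OF a[OF that]] .
    ultimately have eqs: "\<And>i j. i \<in> {1..5} \<Longrightarrow> j \<in> {1..5} \<Longrightarrow> c (int i) = c (int j) \<longleftrightarrow> i = j"
      "\<And>i j. i \<in> S \<Longrightarrow> j \<in> S \<Longrightarrow> a i = a j \<longleftrightarrow> i = j"
      "\<And>i j. j \<in> S \<Longrightarrow> a j \<noteq> c (int i)" "\<And>i j. j \<in> S \<Longrightarrow> c (int i) \<noteq> a j"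
      by metis+
    show ?thesis
    proof (rule inj_onI)
      fix u v assume "u \<in> Vv ` {1..5} \<union> Va ` S" "v \<in> Vv ` {1..5} \<union> Va ` S" "g u = g v"
      then show "u = v"
        by (elim UnE imageE; hypsubst_thin) (simp_all add: g eqs)
    qed
  qed
  moreover have "g ` (Vv ` {1..5} \<union> Va ` S) = V"
  proof
    show "g ` (Vv ` {1..5} \<union> Va ` S) \<subseteq> V"
      using cyc_in_V[OF c] attached_in_V[OF a] by (auto simp: g)
    show "V \<subseteq> g ` (Vv ` {1..5} \<union> Va ` S)"
    proof
      fix z assume "z \<in> V"
      then consider "z \<in> (\<lambda>i. c (int i)) ` {1..5}" | i where "i \<in> {1..5}" "attached c (int i) z"
        using C5_dominates[OF c no7] cyc_range[OF c5] attached_index_in_range[OF c5] by blast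
      then show "z \<in> g ` (Vv ` {1..5} \<union> Va ` S)"
      proof cases
        case 1
        then show ?thesis by (auto simp: g[symmetric])
      next
        case 2
        then show ?thesis
          using only[of i z] by (intro image_eqI[of _ _ "Va i"]) (simp_all add: g)
      qed
    qed
  qed
  moreover have "g u \<sim> g v \<longleftrightarrow>
      (u, v) \<in> cycle_edges Vv 5 \<union> {(Va i, Vv i) | i. i \<in> S} \<union> (\<lambda>(i, j). (Va i, Va j)) ` R \<or>
      (v, u) \<in> cycle_edges Vv 5 \<union> {(Va i, Vv i) | i. i \<in> S} \<union> (\<lambda>(i, j). (Va i, Va j)) ` R"
    if "u \<in> Vv ` {1..5} \<union> Va ` S" "v \<in> Vv ` {1..5} \<union> Va ` S" for u v
    using that
  proof (elim UnE imageE; hypsubst_thin)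
    fix i j assume "i \<in> {1..5::nat}" "j \<in> {1..5::nat}"
    then show "g (Vv i) \<sim> g (Vv j) \<longleftrightarrow>
      (Vv i, Vv j) \<in> cycle_edges Vv 5 \<union> {(Va i, Vv i) | i. i \<in> S} \<union> (\<lambda>(i, j). (Va i, Va j)) ` R \<or>
      (Vv j, Vv i) \<in> cycle_edges Vv 5 \<union> {(Va i, Vv i) | i. i \<in> S} \<union> (\<lambda>(i, j). (Va i, Va j)) ` R"
      using cyc_cycle_edges[OF c5 inj_Vv, of i j] by (auto simp: g)
  qed (auto simp: g aa ca)
  ultimately show ?thesis
    using R(1) S by (intro iso_ugraph[where g = g]) (use cycle_edges_subset[of Vv 5] in auto)
qed

text \<open>
  The common shape of \<open>F2\<close> and \<open>F0'\<close>: the cycle together with disjoint paths of length 3 between its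
  vertices 1 and \<open>m\<close>. The vertices attached at 1 are numbered arbitrarily, and the
  partner map \<open>p\<close> carries the numbering over to those attached at \<open>m\<close>.
\<close>

lemma iso_theta:
  assumes c: "cyc (int n) c" and m: "1 < m" "m \<le> n"
    and cover: "\<And>z. z \<in> V \<Longrightarrow> z \<in> range c \<or> attached c 1 z \<or> attached c (int m) z"
    and adj1: "\<And>x j. attached c 1 x \<Longrightarrow> x \<sim> c j \<longleftrightarrow> (j - 1) mod int n = 0"
    and adjm: "\<And>x j. attached c (int m) x \<Longrightarrow> x \<sim> c j \<longleftrightarrow> (j - int m) mod int n = 0"
    and partner1: "\<And>x. attached c 1 x \<Longrightarrow> \<exists>y. attached c (int m) y \<and> x \<sim> y"
    and partnerm: "\<And>y. attached c (int m) y \<Longrightarrow> \<exists>x. attached c 1 x \<and> x \<sim> y"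
    and ex: "\<exists>x. attached c 1 x"
  shows "\<exists>t\<ge>1. digraph_iso (with_proj G)
    (with_proj (ugraph (Vv ` {1..n} \<union> Vy ` {1..t} \<union> Vz ` {1..t})
      (cycle_edges Vv n \<union> (\<Union>j\<in>{1..t}. {(Vv 1, Vy j), (Vy j, Vz j), (Vz j, Vv m)}))))"
proof -
  let ?X = "{x. attached c 1 x}"
  have "?X \<subseteq> V" using attached_in_V by blast
  then have fin: "finite ?X"
    using finite_subset finite_verts by blast
  define t where "t = card ?X"
  have t: "t \<ge> 1"
    using ex fin by (auto simp: t_def Suc_le_eq card_gt_0_iff)
  obtain h where h: "bij_betw h {1..t} ?X"
    using ex_bij_betw_nat_finite_1[OF fin] by (auto simp: t_def)
  obtain p where p: "\<And>x. attached c 1 x \<Longrightarrow> attached c (int m) (p x) \<and> x \<sim> p x"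
    using partner1 by metis
  define g where "g l = (case l of Vv i \<Rightarrow> c (int i) | Vy i \<Rightarrow> h i | Vz i \<Rightarrow> p (h i) | _ \<Rightarrow> c 0)" for l
  have g: "g (Vv i) = c (int i)" "g (Vy i) = h i" "g (Vz i) = p (h i)" for i
    by (simp_all add: g_def)
  let ?J = "{1..t}" 
  have n: "1 \<le> n" using m by simp
  have h1: "attached c 1 (h j)" if "j \<in> ?J" for j
    using bij_betwE[OF h] that by blast
  have h_surj: "\<exists>j\<in>?J. x = h j" if "attached c 1 x" for x
    using bij_betw_imp_surj_on[OF h] that by (metis image_iff mem_Collect_eq)
  have pm: "attached c (int m) (p (h j))" and hp: "h j \<sim> p (h j)" if "j \<in> ?J" for j
    using p[OF h1[OF that]] by blast+
  have h_eq: "h i = h j \<longleftrightarrow> i = j" if "i \<in> ?J" "j \<in> ?J" for i j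
    using h that by (auto simp: bij_betw_def inj_on_eq_iff)
  have u1: "x = x'" if "attached c 1 x" "attached c 1 x'" "x \<sim> y" "x' \<sim> y" "attached c (int m) y" for x x' y
    using attached_unique[of c 1 x x' y] attached_neq that adj_sym by blast
  have um: "y = y'" if "attached c (int m) y" "attached c (int m) y'" "x \<sim> y" "x \<sim> y'" "attached c 1 x" for x y y'
    using attached_unique[of c "int m" y y' x] attached_neq that adj_sym by blast
  have hpn: "h i \<sim> p (h j) \<longleftrightarrow> i = j" "p (h j) \<sim> h i \<longleftrightarrow> i = j" if "i \<in> ?J" "j \<in> ?J" for i j
    using u1[of "h i" "h j" "p (h j)"] h1[of i] h1[of j] pm[of j] hp[of j] h_eq[of i j] that
      adj_commute[of "p (h j)" "h i"] by auto
  have pp_eq: "p (h i) = p (h j) \<longleftrightarrow> i = j" if "i \<in> ?J" "j \<in> ?J" for i j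
    using hpn(1)[of i j] hp[of i] that by auto
  have disj: "h i \<noteq> p (h j)" if "i \<in> ?J" "j \<in> ?J" for i j
  proof
    assume "h i = p (h j)"
    then have "h i \<sim> c (int m)"
      using pm[OF that(2)] by (simp add: attached_def)
    then have "(int m - int 1) mod int n = 0"
      using adj1[OF h1[OF that(1)]] by simp
    then show False
      using nat_mod_eq_imp_eq[of m 1 n] m by auto
  qed
  have off: "h j \<noteq> c i" "p (h j) \<noteq> c i" "c i \<noteq> h j" "c i \<noteq> p (h j)" if "j \<in> ?J" for i j
    using attached_neq h1[OF that] pm[OF that] by metis+
  have hh: "\<not> h i \<sim> h j" "\<not> p (h i) \<sim> p (h j)" if "i \<in> ?J" "j \<in> ?J" for i j
    using attached_same_nonadj h1 pm that by blast+
  have ch: "h j \<sim> c (int i) \<longleftrightarrow> i = 1" "c (int i) \<sim> h j \<longleftrightarrow> i = 1" 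
    and cp: "p (h j) \<sim> c (int i) \<longleftrightarrow> i = m" "c (int i) \<sim> p (h j) \<longleftrightarrow> i = m"
    if "j \<in> ?J" "i \<in> {1..n}" for i j
    using adj1[OF h1[OF that(1)], of "int i"] adjm[OF pm[OF that(1)], of "int i"]
      nat_mod_eq_imp_eq[of i 1 n] nat_mod_eq_imp_eq[of i m n] m that
      adj_commute[of "c (int i)" "h j"] adj_commute[of "c (int i)" "p (h j)"] by auto
  let ?U = "Vv ` {1..n} \<union> Vy ` ?J \<union> Vz ` ?J"
  let ?E = "cycle_edges Vv n \<union> (\<Union>j\<in>?J. {(Vv 1, Vy j), (Vy j, Vz j), (Vz j, Vv m)})"
  have "digraph_iso (with_proj G) (with_proj (ugraph ?U ?E))"
  proof (rule iso_ugraph)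
    show "?E \<subseteq> ?U \<times> ?U"
      using cycle_edges_subset[of Vv n] m by auto
    have "c (int i) = c (int j) \<longleftrightarrow> i = j" if "i \<in> {1..n}" "j \<in> {1..n}" for i j
      using inj_on_eq_iff[OF cyc_inj_on[OF c] that] .
    note eqs = this h_eq pp_eq disj disj[THEN not_sym] off
    show "inj_on g ?U"
    proof (rule inj_onI)
      fix u v assume "u \<in> ?U" "v \<in> ?U" "g u = g v"
      then show "u = v"
        by (elim UnE imageE; hypsubst_thin) (simp_all add: g eqs)
    qed
    show "g ` ?U = V"
    proof
      show "g ` ?U \<subseteq> V"
        using cyc_in_V[OF c] attached_in_V[OF h1] attached_in_V[OF pm] by (auto simp: g)
      show "V \<subseteq> g ` ?U"
      proof
        fix z assume "z \<in> V"
        then consider "z \<in> range c" | "attached c 1 z" | "attached c (int m) z"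
          using cover by blast
        then show "z \<in> g ` ?U"
        proof cases
          case 1
          then show ?thesis
            unfolding cyc_range[OF c] by (auto simp: g[symmetric])
        next
          case 2
          then obtain j where "j \<in> ?J" "z = h j"
            using h_surj by blast
          then show ?thesis
            by (intro image_eqI[of _ _ "Vy j"]) (simp_all add: g)
        next
          case 3
          then obtain x where x: "attached c 1 x" "x \<sim> z"
            using partnerm by blast
          then obtain j where j: "j \<in> ?J" "x = h j"
            using h_surj by blast
          then have "z = p (h j)"
            using um[OF 3 pm[OF j(1)] x(2)] hp[OF j(1)] x j by simp
          then show ?thesis
            using j by (intro image_eqI[of _ _ "Vz j"]) (simp_all add: g)
        qed
      qed
    qed
    fix u v assume "u \<in> ?U" "v \<in> ?U"
    then show "g u \<sim> g v \<longleftrightarrow> (u, v) \<in> ?E \<or> (v, u) \<in> ?E"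
    proof (elim UnE imageE; hypsubst_thin)
      fix i j assume "i \<in> {1..n}" "j \<in> {1..n}"
      then show "g (Vv i) \<sim> g (Vv j) \<longleftrightarrow> (Vv i, Vv j) \<in> ?E \<or> (Vv j, Vv i) \<in> ?E"
        using cyc_cycle_edges[OF c inj_Vv, of i j] by (auto simp: g)
    qed (auto simp: g hh ch cp hpn)
  qed
  then show ?thesis
    using t by blast
qed

lemma link_shift:
  assumes "cyc 5 c" "\<not> (\<exists>f. cyc 7 f)"
  shows "link (\<lambda>j. c (j + k)) i x y \<longleftrightarrow> link c (i + k) x y"
  unfolding link_def[OF cyc_shift[OF assms(1)] assms(2)] link_def[OF assms] attached_shift
  by (simp add: ac_simps)


context
  fixes c
  assumes c: "cyc 5 c" and no7: "\<not> (\<exists>f. cyc 7 f)"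
begin

definition link_type :: "int \<Rightarrow> bool" where
  "link_type i \<longleftrightarrow> (\<exists>x y. link c i x y)"

lemma link_typeI: "link c i x y \<Longrightarrow> link_type i"
  by (auto simp: link_type_def)

lemma link_type_cong:
  assumes "(j - i) mod 5 = 0"
  shows "link_type i \<longleftrightarrow> link_type j"
proof -
  have "(i - j) mod 5 = 0"
    using assms by presburger
  then show ?thesis
    using link_cong[OF c no7] assms unfolding link_type_def by metis
qed

lemma link_meet:
  assumes "link c i x y" "link c j x' y'" "(j - i) mod 5 = 2"
  shows "y = x'"
proof -
  have "(i + 2 - j) mod 5 = 0"
    using assms(3) by presburger
  then show ?thesis
    using links_share_end[OF c no7 assms(1) link_cong[OF c no7 assms(2)]] by simp
qed

text \<open>
  The diagonal adjacency produced by two links at consecutive positions is itself a link, at \<open>i + 3\<close>.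
  In the pentagram order, where \<open>i + 2\<close> follows \<open>i\<close>, the positions \<open>i + 1\<close>, \<open>i + 3\<close>, \<open>i\<close> are successive. Hence the
  occurring types form an interval of that cyclic order: they are none, all, or one, two or three
  successive ones.
\<close>

lemma link_type_between:
  assumes "link_type i" "link_type j" "(j - i) mod 5 = 1"
  shows "link_type (i + 3)"
proof -
  obtain x y x' y' where l: "link c i x y" "link c j x' y'"
    using assms by (auto simp: link_type_def)
  have "(i + 1 - j) mod 5 = 0"
    using assms(3) by presburger
  then have l': "link c (i + 1) x' y'"
    by (rule link_cong[OF c no7 l(2)])
  have "x \<sim> y'"
    by (rule links_consecutive[OF c no7 l(1) l'])
  moreover have "attached c (i + 5) x"
    by (rule attached_cong[OF c, of i]) (use l in \<open>simp_all add: link_def[OF c no7]\<close>)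
  moreover have "attached c (i + 3) y'"
    using l' by (simp add: link_def[OF c no7] add.assoc)
  ultimately have "link c (i + 3) y' x"
    using adj_sym by (simp add: link_def[OF c no7] add.assoc)
  then show ?thesis
    by (rule link_typeI)
qed

lemma attached_linkE:
  assumes "attached c j u" "(j - h) mod 5 = 2"
  obtains v where "link c j u v" | v where "link c h v u"
proof -
  consider v where "link c j u v" | v where "link c (j - 2) v u"
    using attached5_linked[OF c no7 assms(1)] by blast
  then show thesis
  proof cases
    case 2
    have "(h - (j - 2)) mod 5 = 0"
      using assms(2) by presburger
    then have "link c h v u"
      by (rule link_cong[OF c no7 2])
    then show thesis
      by (rule that(2))
  qed (rule that(1))
qed

text \<open>
  Every vertex attached at \<open>j\<close> is an end of some link, whose other end lies on one of the two sides. A link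
  towards one side shares its end with the given link on the other side.
\<close>

lemma middle_unique:
  assumes l: "link c i x y" "link c j y z" "(j - i) mod 5 = 2" and u: "attached c j u"
  shows "u = y"
  using u l(3)
proof (cases rule: attached_linkE)
  case (1 v)
  then show ?thesis using link_meet[OF l(1) 1 l(3)] by simp
next
  case (2 v)
  then show ?thesis using link_meet[OF 2 l(2) l(3)] by simp
qed

lemma start_unique:
  assumes l: "link c i x y" "link c j y z" "(j - i) mod 5 = 2" and u: "attached c i u"
    and h: "\<not> link_type h" "(i - h) mod 5 = 2"
  shows "u = x"
  using u h(2)
proof (cases rule: attached_linkE)
  case (1 v)
  then have "v = y"
    using link_meet[OF 1 l(2) l(3)] by simp
  then show ?thesis
    using link_left_unique[OF c no7] l(1) 1 by blast
next
  case (2 v)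
  then show ?thesis using h link_typeI by blast
qed

lemma end_unique:
  assumes l: "link c i x y" "link c j y z" "(j - i) mod 5 = 2" and u: "attached c k u"
    and k: "\<not> link_type k" "(k - j) mod 5 = 2"
  shows "u = z"
  using u k(2)
proof (cases rule: attached_linkE)
  case (1 v)
  then show ?thesis using k link_typeI by blast
next
  case (2 v)
  then have "y = v"
    using link_meet[OF l(1) 2 l(3)] by simp
  then show ?thesis
    using link_right_unique[OF c no7] l(2) 2 by blast
qed

lemma not_attached:
  assumes "\<not> link_type j" "\<not> link_type h" "(j - h) mod 5 = 2"
  shows "\<not> attached c j u"
proof
  assume "attached c j u"
  then show False
    using assms(3) by (cases rule: attached_linkE) (use assms link_typeI in blast)+
qed

lemma link_ends:
  assumes "link c i x y" "(j - i) mod 5 = 2"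
  shows "attached c i x" "attached c j y" "x \<sim> y" "y \<sim> x"
proof -
  have a: "attached c i x" "attached c (i + 2) y" "x \<sim> y"
    using assms(1) by (auto simp: link_def[OF c no7])
  have "(j - (i + 2)) mod 5 = 0"
    using assms(2) by presburger
  then have "attached c j y"
    by (rule attached_cong[OF c a(2)])
  then show "attached c i x" "attached c j y" "x \<sim> y" "y \<sim> x"
    using a adj_sym[OF a(3)] by simp_all
qed

lemma iso_F1:
  assumes "\<And>i. \<not> link_type i"
  shows "digraph_iso (with_proj G) F1"
proof -
  have "\<not> attached c i u" for i u
    using not_attached[of i "i - 2"] assms by simp
  then have "digraph_iso (with_proj G) (with_proj (ugraph (Vv ` {1..5} \<union> Va ` {})
    (cycle_edges Vv 5 \<union> {(Va i, Vv i) | i. i \<in> {}} \<union> (\<lambda>(i, j). (Va i, Va j)) ` {})))"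
    by (intro iso_spoked[OF c no7]) auto
  then show ?thesis
    by (simp add: F1_def)
qed

text \<open>
  Only one type of link occurs, so the links form a matching between two classes, of arbitrary size.
\<close>

lemma iso_F2:
  assumes t: "link_type 1" and n: "\<not> link_type 2" "\<not> link_type 3" "\<not> link_type 4" "\<not> link_type 5"
  shows "\<exists>t\<ge>1. digraph_iso (with_proj G) (F2 t)"
proof -
  have n2: "\<not> attached c 2 u" for u by (rule not_attached[of 2 5]) (use n in auto)
  have n4: "\<not> attached c 4 u" for u by (rule not_attached[of 4 2]) (use n in auto)
  have n5: "\<not> attached c 5 u" for u by (rule not_attached[of 5 3]) (use n in auto)
  have c5: "cyc (int 5) c" using c by simp
  have "z \<in> range c \<or> attached c 1 z \<or> attached c (int 3) z" if zV: "z \<in> V" for z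
  proof -
    consider "z \<in> range c" | k where "k \<in> {1..5}" "attached c (int k) z"
      using C5_dominates[OF c no7 zV] attached_index_in_range[OF c5] by blast
    then show ?thesis
      by cases (use n2 n4 n5 in \<open>auto simp: ivl_numeral\<close>)
  qed
  moreover have "\<exists>y. attached c (int 3) y \<and> x \<sim> y" if "attached c 1 x" for x
  proof -
    have "(1 - 4) mod 5 = (2::int)" by simp
    with that show ?thesis
      by (cases rule: attached_linkE) (use n link_ends(2,3)[of 1 x _ 3] link_typeI in auto)
  qed
  moreover have "\<exists>x. attached c 1 x \<and> x \<sim> y" if "attached c (int 3) y" for y
  proof -
    have "attached c 3 y" "(3 - 1) mod 5 = (2::int)" using that by simp_all
    then show ?thesis
      by (cases rule: attached_linkE) (use n link_ends(1,3)[of 1 _ y 3] link_typeI in auto)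
  qed
  moreover have "\<exists>x. attached c 1 x"
    using t link_ends(1)[of 1 _ _ 3] by (auto simp: link_type_def)
  ultimately have "\<exists>t\<ge>1. digraph_iso (with_proj G)
    (with_proj (ugraph (Vv ` {1..5} \<union> Vy ` {1..t} \<union> Vz ` {1..t})
      (cycle_edges Vv 5 \<union> (\<Union>j\<in>{1..t}. {(Vv 1, Vy j), (Vy j, Vz j), (Vz j, Vv 3)}))))"
    by (intro iso_theta[OF c5]) (use attached5_adj_iff[OF c no7] in simp_all)
  then show ?thesis
    by (simp add: F2_def)
qed

lemma iso_F3:
  assumes l: "link c 4 x y" "link c 1 y z"
    and n: "\<not> link_type 2" "\<not> link_type 3" "\<not> link_type 5"
  shows "digraph_iso (with_proj G) F3"
proof -
  define a :: "nat \<Rightarrow> 'a" where "a i = (if i = 4 then x else if i = 1 then y else z)" for i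
  have a: "a 4 = x" "a 1 = y" "a (Suc 0) = y" "a 3 = z" by (simp_all add: a_def)
  have u4: "u = x" if "attached c 4 u" for u by (rule start_unique[OF l _ that n(1)]) auto
  have u1: "u = y" if "attached c 1 u" for u by (rule middle_unique[OF l _ that]) auto
  have u3: "u = z" if "attached c 3 u" for u by (rule end_unique[OF l _ that n(2)]) auto
  have n2: "\<not> attached c 2 u" for u by (rule not_attached[of 2 5]) (use n in auto)
  have n5: "\<not> attached c 5 u" for u by (rule not_attached[of 5 3]) (use n in auto)
  note at = link_ends[OF l(1), of 1] link_ends[OF l(2), of 3]
  have "digraph_iso (with_proj G) (with_proj (ugraph (Vv ` {1..5} \<union> Va ` {1,3,4})
    (cycle_edges Vv 5 \<union> {(Va i, Vv i) | i. i \<in> {1,3,4}} \<union> (\<lambda>(i, j). (Va i, Va j)) ` {(1,3), (1,4)})))"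
  proof (rule iso_spoked[OF c no7, where a = a])
    fix i u assume "i \<in> {1..5::nat}" "attached c (int i) u"
    then show "i \<in> {1, 3, 4} \<and> u = a i"
      using u4 u1 u3 n2 n5 by (auto simp: ivl_numeral a)
  next
    have H: "\<forall>i\<in>{1,3,4::nat}. \<forall>j\<in>{1,3,4::nat}. (int j - int i) mod 5 \<in> {2, 3} \<longrightarrow>
        (i, j) \<in> {(1,3), (1,4)} \<or> (j, i) \<in> {(1,3), (1,4)}"
      by (simp add: ivl_numeral)
    show "(i, j) \<in> {(1,3), (1,4)} \<or> (j, i) \<in> {(1,3), (1,4)}"
      if "i \<in> {1,3,4::nat}" "j \<in> {1,3,4::nat}" "(int j - int i) mod 5 \<in> {2, 3}" for i j
      by (rule H[THEN bspec, OF that(1), THEN bspec, OF that(2), THEN mp, OF that(3)])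
  qed (use at in \<open>auto simp: a\<close>)
  then show ?thesis
    by (simp add: F3_def)
qed

lemma iso_F4:
  assumes l: "link c 4 x y" "link c 1 y z" "link c 3 z w"
    and n: "\<not> link_type 2" "\<not> link_type 5"
  shows "digraph_iso (with_proj G) F4"
proof -
  define a :: "nat \<Rightarrow> 'a" where
    "a i = (if i = 4 then x else if i = 1 then y else if i = 3 then z else w)" for i
  have a: "a 4 = x" "a 1 = y" "a (Suc 0) = y" "a 3 = z" "a 5 = w" by (simp_all add: a_def)
  have u4: "u = x" if "attached c 4 u" for u by (rule start_unique[OF l(1,2) _ that n(1)]) auto
  have u1: "u = y" if "attached c 1 u" for u by (rule middle_unique[OF l(1,2) _ that]) auto
  have u3: "u = z" if "attached c 3 u" for u by (rule middle_unique[OF l(2,3) _ that]) auto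
  have u5: "u = w" if "attached c 5 u" for u by (rule end_unique[OF l(2,3) _ that n(2)]) auto
  have n2: "\<not> attached c 2 u" for u by (rule not_attached[of 2 5]) (use n in auto)
  note at = link_ends[OF l(1), of 1] link_ends[OF l(2), of 3] link_ends[OF l(3), of 5]
  have "digraph_iso (with_proj G) (with_proj (ugraph (Vv ` {1..5} \<union> Va ` {1,3,4,5})
    (cycle_edges Vv 5 \<union> {(Va i, Vv i) | i. i \<in> {1,3,4,5}} \<union>
     (\<lambda>(i, j). (Va i, Va j)) ` {(1,3), (1,4), (3,5)})))"
  proof (rule iso_spoked[OF c no7, where a = a])
    fix i u assume "i \<in> {1..5::nat}" "attached c (int i) u"
    then show "i \<in> {1, 3, 4, 5} \<and> u = a i"
      using u4 u1 u3 u5 n2 by (auto simp: ivl_numeral a)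
  next
    have H: "\<forall>i\<in>{1,3,4,5::nat}. \<forall>j\<in>{1,3,4,5::nat}. (int j - int i) mod 5 \<in> {2, 3} \<longrightarrow>
        (i, j) \<in> {(1,3), (1,4), (3,5)} \<or> (j, i) \<in> {(1,3), (1,4), (3,5)}"
      by (simp add: ivl_numeral)
    show "(i, j) \<in> {(1,3), (1,4), (3,5)} \<or> (j, i) \<in> {(1,3), (1,4), (3,5)}"
      if "i \<in> {1,3,4,5::nat}" "j \<in> {1,3,4,5::nat}" "(int j - int i) mod 5 \<in> {2, 3}" for i j
      by (rule H[THEN bspec, OF that(1), THEN bspec, OF that(2), THEN mp, OF that(3)])
  qed (use at in \<open>auto simp: a\<close>)
  then show ?thesis
    by (simp add: F4_def)
qed

lemma iso_F5:
  assumes "\<And>i. link_type i"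
  shows "digraph_iso (with_proj G) F5"
proof -
  obtain x y where l4: "link c 4 x y"
    using assms[of 4, unfolded link_type_def] by blast
  obtain y' z where l1: "link c 1 y' z"
    using assms[of 1, unfolded link_type_def] by blast
  obtain z' w where l3: "link c 3 z' w"
    using assms[of 3, unfolded link_type_def] by blast
  obtain w' v where l5: "link c 5 w' v"
    using assms[of 5, unfolded link_type_def] by blast
  obtain v' x' where l2: "link c 2 v' x'"
    using assms[of 2, unfolded link_type_def] by blast
  have "y = y'" "z = z'" "w = w'" "v = v'" "x' = x"
    using link_meet[OF l4 l1] link_meet[OF l1 l3] link_meet[OF l3 l5] link_meet[OF l5 l2]
      link_meet[OF l2 l4] by simp_all
  then have l: "link c 4 x y" "link c 1 y z" "link c 3 z w" "link c 5 w v" "link c 2 v x"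
    using l4 l1 l3 l5 l2 by simp_all
  define a :: "nat \<Rightarrow> 'a" where
    "a i = (if i = 4 then x else if i = 1 then y else if i = 3 then z else if i = 5 then w else v)" for i
  have a: "a 4 = x" "a 1 = y" "a (Suc 0) = y" "a 3 = z" "a 5 = w" "a 2 = v" by (simp_all add: a_def)
  have u: "u = y" if "attached c 1 u" for u by (rule middle_unique[OF l(1,2) _ that]) auto
  have u3: "u = z" if "attached c 3 u" for u by (rule middle_unique[OF l(2,3) _ that]) auto
  have u5: "u = w" if "attached c 5 u" for u by (rule middle_unique[OF l(3,4) _ that]) auto
  have u2: "u = v" if "attached c 2 u" for u by (rule middle_unique[OF l(4,5) _ that]) auto
  have u4: "u = x" if "attached c 4 u" for u by (rule middle_unique[OF l(5,1) _ that]) auto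
  note at = link_ends[OF l(1), of 1] link_ends[OF l(2), of 3] link_ends[OF l(3), of 5]
    link_ends[OF l(4), of 2] link_ends[OF l(5), of 4]
  have "digraph_iso (with_proj G) (with_proj (ugraph (Vv ` {1..5} \<union> Va ` {1..5})
    (cycle_edges Vv 5 \<union> {(Va i, Vv i) | i. i \<in> {1..5}} \<union>
     (\<lambda>(i, j). (Va i, Va j)) ` {(1,3), (3,5), (5,2), (2,4), (4,1)})))"
  proof (rule iso_spoked[OF c no7, where a = a])
    fix i u' assume "i \<in> {1..5::nat}" "attached c (int i) u'"
    then show "i \<in> {1..5} \<and> u' = a i"
      using u u2 u3 u4 u5 by (auto simp: ivl_numeral a)
  next
    fix i assume "i \<in> {1..5::nat}"
    then show "attached c (int i) (a i)"
      using at by (auto simp: ivl_numeral a)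
  next
    have H: "\<forall>i\<in>{1..5::nat}. \<forall>j\<in>{1..5::nat}. (int j - int i) mod 5 \<in> {2, 3} \<longrightarrow>
        (i, j) \<in> {(1,3), (3,5), (5,2), (2,4), (4,1)} \<or> (j, i) \<in> {(1,3), (3,5), (5,2), (2,4), (4,1)}"
      by (simp add: ivl_numeral)
    show "(i, j) \<in> {(1,3), (3,5), (5,2), (2,4), (4,1)} \<or> (j, i) \<in> {(1,3), (3,5), (5,2), (2,4), (4,1)}"
      if "i \<in> {1..5::nat}" "j \<in> {1..5::nat}" "(int j - int i) mod 5 \<in> {2, 3}" for i j
      by (rule H[THEN bspec, OF that(1), THEN bspec, OF that(2), THEN mp, OF that(3)])
  qed (use at in \<open>auto simp: a\<close>)
  then show ?thesis
    by (simp add: F5_def)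
qed

end

lemma link_type_shift:
  assumes "cyc 5 c" "\<not> (\<exists>f. cyc 7 f)"
  shows "link_type (\<lambda>j. c (j + k)) i \<longleftrightarrow> link_type c (i + k)"
  unfolding link_type_def[OF cyc_shift[OF assms(1)] assms(2)] link_type_def[OF assms] link_shift[OF assms] ..

text \<open>
  The occurring link types are an interval of the pentagram order. If it is neither empty nor
  everything, rotate so that it starts at 1 (for \<open>F2\<close>, whose extra paths join \<open>v\<^sub>1\<close> and \<open>v\<^sub>3\<close>) or at 4 (for \<open>F3\<close> and
  \<open>F4\<close>, whose inner path visits \<open>a\<^sub>4\<close>, \<open>a\<^sub>1\<close>, \<open>a\<^sub>3\<close> and then \<open>a\<^sub>5\<close>).
\<close>

lemma classify_C5:
  assumes c: "cyc 5 c" and no7: "\<not> (\<exists>f. cyc 7 f)"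
  shows "\<exists>F\<in>frak_F. digraph_iso (with_proj G) F"
proof -
  let ?T = "link_type c"
  note T = link_type_shift[OF c no7]
  consider "\<And>i. \<not> ?T i" | "\<And>i. ?T i" | i where "?T i" "\<not> ?T (i - 2)"
  proof (cases "\<exists>i. ?T i \<and> \<not> ?T (i - 2)")
    case False
    then have step: "?T (i - 2)" if "?T i" for i using that by blast
    have "?T j" if i: "?T i" for i j
    proof -
      have T: "?T (i - 2)" "?T (i - 4)" "?T (i - 6)" "?T (i - 8)"
        using i step[of i] step[of "i - 2"] step[of "i - 4"] step[of "i - 6"] by simp_all
      have eq: "?T j" if "?T k" "(j - k) mod 5 = 0" for k
        using link_type_cong[OF c no7 that(2)] that(1) by simp
      show ?thesis
      proof (cases rule: mod5_cases[of j i])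
        case 1 show ?thesis by (rule eq[OF i 1])
      next
        case 2 show ?thesis by (rule eq[OF T(2)]) (use 2 in presburger)
      next
        case 3 show ?thesis by (rule eq[OF T(4)]) (use 3 in presburger)
      next
        case 4 show ?thesis by (rule eq[OF T(1)]) (use 4 in presburger)
      next
        case 5 show ?thesis by (rule eq[OF T(3)]) (use 5 in presburger)
      qed
    qed
    then show thesis using that(1,2) by blast
  next
    case True
    then show thesis using that(3) by blast
  qed
  then show ?thesis
  proof cases
    case 1
    then show ?thesis using iso_F1[OF c no7] by (auto simp: frak_F_def)
  next
    case 2
    then show ?thesis using iso_F5[OF c no7] by (auto simp: frak_F_def)
  next
    case (3 i)
    have btw: "?T (j + 3)" if "?T j" "?T (j + 1)" for j
      by (rule link_type_between[OF c no7 that]) simp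
    have eq: "?T j \<longleftrightarrow> ?T j'" if "(j' - j) mod 5 = 0" for j j'
      by (rule link_type_cong[OF c no7 that])
    have n3: "\<not> ?T (i + 3)" using 3 eq[of "i + 3" "i - 2"] by simp
    have n1: "\<not> ?T (i + 1)" using btw[of i] 3 n3 by blast
    show ?thesis
    proof (cases "?T (i + 2)")
      case t2: False
      have n4: "\<not> ?T (i + 4)"
        using btw[of "i + 4"] eq[of i "i + 5"] eq[of "i + 2" "i + 7"] 3 t2 by (auto simp: add.assoc)
      have idx: "1 + (i - 1) = i" "2 + (i - 1) = i + 1" "3 + (i - 1) = i + 2"
          "4 + (i - 1) = i + 3" "5 + (i - 1) = i + 4"
        by simp_all
      have "\<exists>t\<ge>1. digraph_iso (with_proj G) (F2 t)"
        by (rule iso_F2[OF cyc_shift[OF c] no7, of "i - 1"])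
          (use 3 n1 t2 n3 n4 in \<open>simp_all only: T idx not_False_eq_True\<close>)
      then show ?thesis by (auto simp: frak_F_def)
    next
      case t2: True
      let ?c = "\<lambda>j. c (j + (i - 4))"
      have c': "cyc 5 ?c" by (rule cyc_shift[OF c])
      have t4: "link_type ?c 4" using 3 by (simp add: T)
      have t1: "link_type ?c 1" using t2 eq[of "i + 2" "i - 3"] by (simp add: T)
      have t2': "\<not> link_type ?c 2" using 3 by (simp add: T)
      have idx: "5 + (i - 4) = i + 1" by simp
      have t5: "\<not> link_type ?c 5" using n1 by (simp only: T idx not_False_eq_True)
      obtain x y where l4: "link ?c 4 x y"
        using t4 by (auto simp: link_type_def[OF c' no7])
      obtain y' z where l1: "link ?c 1 y' z"
        using t1 by (auto simp: link_type_def[OF c' no7])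
      have "y = y'"
        by (rule link_meet[OF c' no7 l4 l1]) simp
      note l1 = l1[folded this]
      show ?thesis
      proof (cases "link_type ?c 3")
        case True
        then obtain z' w where l3: "link ?c 3 z' w"
          by (auto simp: link_type_def[OF c' no7])
        have "z = z'"
          by (rule link_meet[OF c' no7 l1 l3]) simp
        note l3 = l3[folded this]
        show ?thesis
          using iso_F4[OF c' no7 l4 l1 l3 t2' t5] by (auto simp: frak_F_def)
      next
        case False
        show ?thesis
          using iso_F3[OF c' no7 l4 l1 t2' False t5] by (auto simp: frak_F_def)
      qed
    qed
  qed
qed


section \<open>Structure around a 6-cycle in the absence of 5-cycles\<close>

lemma iso_cycle:
  assumes c: "cyc (int n) c" and V: "V \<subseteq> range c" and f: "inj f"
  shows "digraph_iso (with_proj G) (with_proj (ugraph (f ` {1..n}) (cycle_edges f n)))"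
proof (rule iso_ugraph)
  define g where "g l = c (int (inv f l))" for l
  have g: "g (f i) = c (int i)" for i
    using f by (simp add: g_def)
  show "cycle_edges f n \<subseteq> f ` {1..n} \<times> f ` {1..n}"
    by (rule cycle_edges_subset)
  show "inj_on g (f ` {1..n})"
  proof (rule inj_onI, elim imageE, hypsubst_thin)
    fix i j assume "i \<in> {1..n}" "j \<in> {1..n}" "g (f i) = g (f j)"
    then show "f i = f j"
      using inj_on_eq_iff[OF cyc_inj_on[OF c], of i j] by (simp add: g)
  qed
  have "g ` f ` {1..n} = range c"
    unfolding cyc_range[OF c] by (simp add: image_image g)
  also have "\<dots> = V"
    using V cyc_in_V[OF c] by auto
  finally show "g ` f ` {1..n} = V" .
  fix u v assume "u \<in> f ` {1..n}" "v \<in> f ` {1..n}"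
  then show "g u \<sim> g v \<longleftrightarrow> (u, v) \<in> cycle_edges f n \<or> (v, u) \<in> cycle_edges f n"
  proof (elim imageE, hypsubst_thin)
    fix i j assume "i \<in> {1..n}" "j \<in> {1..n}"
    then show "g (f i) \<sim> g (f j) \<longleftrightarrow> (f i, f j) \<in> cycle_edges f n \<or> (f j, f i) \<in> cycle_edges f n"
      using cyc_cycle_edges[OF c f, of i j] by (simp add: g)
  qed
qed

context
  fixes c
  assumes c: "cyc 6 c" and no5: "\<not> (\<exists>f. cyc 5 f)"
begin

lemma attached6_adj_iff:
  assumes x: "attached c i x"
  shows "x \<sim> c j \<longleftrightarrow> (j - i) mod 6 = 0"
proof
  assume xj: "x \<sim> c j"
  then have "(j - i) mod 6 \<notin> {1, 2, 4, 5}"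
    using cyc_neighbours_far[OF c, of x i j] x by (auto simp: attached_def)
  moreover have "(j - i) mod 6 \<noteq> 3"
  proof
    assume "(j - i) mod 6 = 3"
    then have "c j = c (i + 3)"
      by (rule cyc_add[OF c])
    then have "x \<sim> c i" "c (i + 3) \<sim> x"
      using x xj adj_sym by (auto simp: attached_def)
    moreover have "c i \<sim> c (i + 1)" "c (i + 1) \<sim> c (i + 2)" "c (i + 2) \<sim> c (i + 3)"
      by (simp_all add: cyc_adj[OF c])
    ultimately show False
      using cyc5_of_edges no5 by blast
  qed
  moreover have "(j - i) mod 6 \<in> {0..<6}"
    by simp
  ultimately show "(j - i) mod 6 = 0"
    by auto
next
  assume "(j - i) mod 6 = 0"
  then have "attached c j x"
    by (rule attached_cong[OF c x])
  then show "x \<sim> c j"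
    by (simp add: attached_def)
qed

lemma adj_attached6_iff: "attached c i x \<Longrightarrow> c j \<sim> x \<longleftrightarrow> (j - i) mod 6 = 0"
  using attached6_adj_iff[of i x j] adj_commute[of "c j" x] by simp

text \<open>
  Adjacent vertices attached at positions at distance 0, 1 or 2 would close a triangle, a 4-cycle or a
  5-cycle.
\<close>

lemma attached6_near_nonadj:
  assumes x: "attached c i x" and y: "attached c j y" and d: "(j - i) mod 6 \<in> {0, 1, 2}"
  shows "\<not> x \<sim> y"
proof
  assume xy: "x \<sim> y"
  have e: "c i \<sim> c (i + 1)" "c (i + 1) \<sim> c (i + 2)"
    by (simp_all add: cyc_adj[OF c])
  have "(i - j) mod 6 = 0 \<or> (i + 1 - j) mod 6 = 0 \<or> (i + 2 - j) mod 6 = 0"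
    using d unfolding insert_iff empty_iff by presburger
  then consider "attached c i y" | "attached c (i + 1) y" | "attached c (i + 2) y"
    using attached_cong[OF c y] by metis
  then show False
  proof cases
    case 1
    then show False using attached_same_nonadj x xy by blast
  next
    case 2
    then show False
      using no_square[of x "c i" "c (i + 1)" y] x xy e adj_sym by (auto simp: attached_def)
  next
    case 3
    have "x \<sim> c i" "c (i + 2) \<sim> y" "y \<sim> x"
      using 3 x xy adj_sym by (auto simp: attached_def)
    then show False
      using cyc5_of_edges e no5 by blast
  qed
qed

lemma attached6_opposite:
  assumes "attached c i x" "attached c j y" "x \<sim> y"
  shows "(j - i) mod 6 = 3"
proof -
  have "(j - i) mod 6 \<notin> {0, 1, 2}" "(i - j) mod 6 \<notin> {0, 1, 2}"
    using attached6_near_nonadj[OF assms(1,2)] attached6_near_nonadj[OF assms(2,1)] assms(3) adj_sym[OF assms(3)] by metis+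
  then show ?thesis
    using mod6_cases[of j i] by (auto simp: mod_diff_swap[of i j])
qed

lemma attached6_nonadj: "attached c i x \<Longrightarrow> attached c j y \<Longrightarrow> (j - i) mod 6 \<noteq> 3 \<Longrightarrow> \<not> x \<sim> y"
  using attached6_opposite by blast

text \<open>
  A vertex at distance 2 from the cycle would start an induced path through its attached neighbour and
  five consecutive vertices of the cycle.
\<close>

lemma C6_dominates:
  assumes "z \<in> V"
  shows "z \<in> range c \<or> (\<exists>i. attached c i z)"
proof (rule ccontr)
  assume z: "\<not> (z \<in> range c \<or> (\<exists>i. attached c i z))"
  let ?U = "{z \<in> V. z \<in> range c \<or> (\<exists>i. attached c i z)}"
  have "c 0 \<in> ?U"
    using cyc_in_V[OF c] by simp
  then have "?U \<subseteq> V" "?U \<noteq> {}" "?U \<noteq> V"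
    using assms z by blast+
  from crossing_edge[OF this] obtain x y
    where x: "x \<in> ?U" and y: "y \<in> V" "y \<notin> ?U" "x \<sim> y"
    by blast
  have y': "y \<notin> range c" "\<not> y \<sim> c j" for j
    using y by (auto simp: attached_def)
  obtain i where i: "attached c i x"
    using x y' y(3) adj_sym by blast
  have "y \<sim> x" using y adj_sym by blast
  then show False
    using no_path7[of y x "c i" "c (i + 1)" "c (i + 2)" "c (i + 3)" "c (i + 4)"]
    by (simp add: y' attached6_adj_iff[OF i] adj_attached6_iff[OF i] cyc_adj[OF c])
qed

lemma opposite_partner:
  assumes "attached c i x"
  shows "\<exists>y. attached c (i + 3) y \<and> x \<sim> y"
proof -
  obtain y where y: "x \<sim> y" "y \<noteq> c i"
    using another_neighbour attached_in_V[OF assms] by blast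
  have "y \<notin> range c"
  proof
    assume "y \<in> range c"
    then obtain j where "y = c j" by auto
    then show False
      using y attached6_adj_iff[OF assms, of j] cyc_eq[OF c, of j i] by simp
  qed
  then obtain j where j: "attached c j y"
    using C6_dominates y in_arcsD2 by blast
  have "(i + 3 - j) mod 6 = 0"
    using attached6_opposite[OF assms j y(1)] by presburger
  then have "attached c (i + 3) y"
    by (rule attached_cong[OF c j])
  then show ?thesis
    using y by blast
qed

text \<open>
  The two paths of length 3 between opposite vertices, taken at neighbouring positions, contain the
  induced path \<open>y, x, c i, c (i + 1), x', y', c (i + 4)\<close>.
\<close>

lemma no_crossing_pairs:
  assumes a: "attached c i x" "attached c (i + 3) y" "x \<sim> y"
    and b: "attached c (i + 1) x'" "attached c (i + 4) y'" "x' \<sim> y'"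
  shows False
proof -
  have "\<not> x \<sim> x'" "\<not> x \<sim> y'" "\<not> y \<sim> x'" "\<not> y \<sim> y'"
    by (rule attached6_nonadj[OF a(1) b(1)] attached6_nonadj[OF a(1) b(2)] attached6_nonadj[OF a(2) b(1)]
        attached6_nonadj[OF a(2) b(2)]; simp)+
  moreover have "y \<sim> x" using a adj_sym by blast
  ultimately show False
    using no_path7[of y x "c i" "c (i + 1)" x' y' "c (i + 4)"] b(3)
    by (simp add: attached6_adj_iff[OF a(1)] attached6_adj_iff[OF a(2)] attached6_adj_iff[OF b(1)] attached6_adj_iff[OF b(2)]
      adj_attached6_iff[OF a(1)] adj_attached6_iff[OF a(2)] adj_attached6_iff[OF b(1)] adj_attached6_iff[OF b(2)] cyc_adj[OF c])
qed

text \<open>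
  Each attached vertex brings its opposite partner, so positions at distance 1 or 2 always produce two
  crossing pairs at neighbouring positions.
\<close>

lemma attached6_not_close:
  assumes x: "attached c i x" and z: "attached c j z" and d: "(j - i) mod 6 = 1 \<or> (j - i) mod 6 = 2"
  shows False
proof -
  obtain y where y: "attached c (i + 3) y" "x \<sim> y"
    using opposite_partner[OF x] by blast
  obtain w where w: "attached c (j + 3) w" "z \<sim> w"
    using opposite_partner[OF z] by blast
  show False
    using d
  proof
    assume d: "(j - i) mod 6 = 1"
    have "attached c (i + 1) z" by (rule attached_cong[OF c z]) (use d in presburger)
    moreover have "attached c (i + 4) w" by (rule attached_cong[OF c w(1)]) (use d in presburger)
    ultimately show False
      using no_crossing_pairs[OF x y] w by blast
  next
    assume d: "(j - i) mod 6 = 2"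
    have "attached c (j + 1) y" by (rule attached_cong[OF c y(1)]) (use d in presburger)
    moreover have "attached c (j + 4) x" by (rule attached_cong[OF c x]) (use d in presburger)
    ultimately show False
      using no_crossing_pairs[OF z w] y(2)[THEN adj_sym] by blast
  qed
qed

lemma attached6_same_or_opposite:
  assumes x: "attached c i x" and z: "attached c j z"
  shows "(j - i) mod 6 = 0 \<or> (j - i) mod 6 = 3"
proof -
  have "(j - i) mod 6 \<noteq> 1" "(j - i) mod 6 \<noteq> 2" "(i - j) mod 6 \<noteq> 1" "(i - j) mod 6 \<noteq> 2"
    using attached6_not_close[OF x z] attached6_not_close[OF z x] by blast+
  then show ?thesis
    using mod6_cases[of j i] by (auto simp: mod_diff_swap[of i j])
qed

end

text \<open>
  All attached vertices sit at one pair of opposite positions and are matched across it.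
\<close>

lemma classify_C6:
  assumes c: "cyc 6 c" and no5: "\<not> (\<exists>f. cyc 5 f)"
  shows "\<exists>F\<in>frak_F. digraph_iso (with_proj G) F"
proof (cases "\<exists>i x. attached c i x")
  case False
  then have "V \<subseteq> range c"
    using C6_dominates[OF c no5] by blast
  moreover have "cyc (int 6) c" using c by simp
  ultimately have "digraph_iso (with_proj G) F0"
    unfolding F0_def using iso_cycle inj_Vv by blast
  then show ?thesis
    by (auto simp: frak_F_def)
next
  case True
  then obtain i x where x: "attached c i x" by blast
  let ?c = "\<lambda>j. c (j + (i - 1))"
  have c': "cyc 6 ?c" by (rule cyc_shift[OF c])
  have x': "attached ?c 1 x" using x by (simp add: attached_shift)
  have cong: "attached ?c k z" if "attached ?c j z" "(k - j) mod 6 = 0" for j k z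
    by (rule attached_cong[OF c' that])
  have "\<exists>t\<ge>1. digraph_iso (with_proj G)
    (with_proj (ugraph (Vv ` {1..6} \<union> Vy ` {1..t} \<union> Vz ` {1..t})
      (cycle_edges Vv 6 \<union> (\<Union>j\<in>{1..t}. {(Vv 1, Vy j), (Vy j, Vz j), (Vz j, Vv 4)}))))"
  proof (rule iso_theta[where c = ?c])
    show "cyc (int 6) ?c" using c' by simp
    show "z \<in> range ?c \<or> attached ?c 1 z \<or> attached ?c (int 4) z" if z: "z \<in> V" for z
    proof (cases "z \<in> range ?c")
      case False
      then obtain j where j: "attached ?c j z"
        using C6_dominates[OF c' no5 z] by blast
      have "(j - 1) mod 6 = 0 \<or> (j - 1) mod 6 = 3"
        by (rule attached6_same_or_opposite[OF c' no5 x' j])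
      then have "(1 - j) mod 6 = 0 \<or> (4 - j) mod 6 = 0"
        by presburger
      then show ?thesis
        using cong[OF j, of 1] cong[OF j, of 4] by auto
    qed simp
    show "\<exists>y. attached ?c (int 4) y \<and> x \<sim> y" if "attached ?c 1 x" for x
      using opposite_partner[OF c' no5 that] by simp
    show "\<exists>x. attached ?c 1 x \<and> x \<sim> y" if y: "attached ?c (int 4) y" for y
    proof -
      have "attached ?c 4 y" using y by simp
      from opposite_partner[OF c' no5 this] obtain x where x: "attached ?c 7 x" "y \<sim> x"
        by auto
      then show ?thesis
        using cong[OF x(1), of 1] adj_sym by auto
    qed
    show "\<exists>x. attached ?c 1 x" using x' by blast
  qed (simp_all add: attached6_adj_iff[OF c' no5])
  then show ?thesis
    by (auto simp: frak_F_def F0'_def)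
qed


section \<open>Structure around a 7-cycle\<close>

text \<open>
  On the cycle \<open>x\<^sub>1, \<dots>, x\<^sub>7\<close> of \<open>F12\<close>, the handles at 4, 5 and 1 are \<open>x\<^sub>8\<close>, \<open>x\<^sub>9\<close> and \<open>x\<^sub>1\<^sub>1\<close>: the index of a handle
  is the midpoint of the longer arc between its two neighbours.
\<close>

definition handle :: "(int \<Rightarrow> 'a) \<Rightarrow> int \<Rightarrow> 'a \<Rightarrow> bool" where
  "handle c k x \<longleftrightarrow> x \<notin> range c \<and> x \<sim> c (k + 2) \<and> x \<sim> c (k - 2)"

text \<open>
  The role of \<open>x\<^sub>1\<^sub>0\<close> in \<open>F12\<close>.
\<close>

definition outer :: "(int \<Rightarrow> 'a) \<Rightarrow> 'a \<Rightarrow> bool" where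
  "outer c x \<longleftrightarrow> x \<in> V \<and> x \<notin> range c \<and> (\<forall>j. \<not> x \<sim> c j)"

lemma handle_shift: "handle (\<lambda>j. c (j + s)) k x \<longleftrightarrow> handle c (k + s) x"
  by (simp add: handle_def range_shift algebra_simps)

context
  fixes c
  assumes c: "cyc 7 c"
begin

lemma handle_cong:
  assumes "handle c k x" "(l - k) mod 7 = 0"
  shows "handle c l x"
proof -
  have "c (l + 2) = c (k + 2)" "c (l - 2) = c (k - 2)"
    using assms(2) cyc_eq[OF c] by simp_all
  then show ?thesis
    using assms(1) by (simp add: handle_def)
qed

lemma handle_offset:
  assumes "handle c l x"
  shows "handle c (k + (l - k) mod 7) x"
proof (rule handle_cong[OF assms])
  have "k + (l - k) mod 7 - l = (l - k) mod 7 - (l - k)"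
    by simp
  then show "(k + (l - k) mod 7 - l) mod 7 = 0"
    by (simp only: mod_diff_left_eq) simp
qed

lemma cyc7_neighbour_diff:
  assumes "x \<notin> range c" "x \<sim> c i" "x \<sim> c j"
  shows "(j - i) mod 7 \<in> {0, 3, 4}"
  using cyc_neighbours_far[OF c assms] mod7_cases[of j i] by auto

lemma handle_adj_iff:
  assumes x: "handle c k x"
  shows "x \<sim> c j \<longleftrightarrow> (j - k) mod 7 = 2 \<or> (j - k) mod 7 = 5"
proof
  assume j: "x \<sim> c j"
  have "(j - (k + 2)) mod 7 \<in> {0, 3, 4}" "(j - (k - 2)) mod 7 \<in> {0, 3, 4}"
    by (rule cyc7_neighbour_diff; use x j in \<open>simp add: handle_def\<close>)+
  then have A: "((j - k) mod 7 - 2) mod 7 \<in> {0, 3, 4}" "((j - k) mod 7 + 2) mod 7 \<in> {0, 3, 4}"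
    unfolding mod_diff_left_eq mod_add_left_eq by (simp_all add: algebra_simps)
  have "d = 2 \<or> d = 5" if "d \<in> {0, 1, 2, 3, 4, 5, 6}" "(d - 2) mod 7 \<in> {0, 3, 4}"
    "(d + 2) mod 7 \<in> {0, 3, 4}" for d :: int
    using that by auto
  from this[OF mod7_cases A] show "(j - k) mod 7 = 2 \<or> (j - k) mod 7 = 5" .
next
  assume "(j - k) mod 7 = 2 \<or> (j - k) mod 7 = 5"
  then have "c j = c (k + 2) \<or> c j = c (k + 5)"
    using cyc_add[OF c, of j k 2] cyc_add[OF c, of j k 5] by argo
  moreover have "c (k + 5) = c (k - 2)"
    by (simp add: cyc_eq[OF c])
  ultimately show "x \<sim> c j"
    using x by (auto simp: handle_def)
qed

lemma adj_handle_iff: "handle c k x \<Longrightarrow> c j \<sim> x \<longleftrightarrow> (j - k) mod 7 = 2 \<or> (j - k) mod 7 = 5"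
  using handle_adj_iff[of k x j] adj_commute[of "c j" x] by simp

lemma handle_in_V: "handle c k x \<Longrightarrow> x \<in> V"
  by (auto simp: handle_def dest: in_arcsD1)

text \<open>
  A vertex with the single neighbour \<open>c j\<close> would extend the path \<open>c j, \<dots>, c (j + 5)\<close> to an induced path on
  seven vertices. By girth a further neighbour is at distance 3 from \<open>c j\<close>.
\<close>

lemma ex_handle:
  assumes x: "x \<notin> range c" "x \<sim> c j"
  shows "\<exists>k. handle c k x"
proof -
  have far: "\<not> x \<sim> c i" if "(i - j) mod 7 \<in> {1, 2, 5, 6}" for i
  proof
    assume "x \<sim> c i"
    from cyc7_neighbour_diff[OF x this] that show False by auto
  qed
  have "x \<sim> c (j + 3) \<or> x \<sim> c (j + 4)"
  proof (rule ccontr)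
    assume "\<not> ?thesis"
    then show False
      using no_path7[of x "c j" "c (j + 1)" "c (j + 2)" "c (j + 3)" "c (j + 4)" "c (j + 5)"] x
        far[of "j + 1"] far[of "j + 2"] far[of "j + 5"]
      by (simp add: cyc_adj[OF c])
  qed
  moreover have "handle c (j + 5) x" if "x \<sim> c (j + 3)"
  proof -
    have eq: "c (j + 5 + 2) = c j" "c (j + 5 - 2) = c (j + 3)"
      by (simp_all add: cyc_eq[OF c])
    show ?thesis
      unfolding handle_def eq using x that by blast
  qed
  moreover have "handle c (j + 2) x" if "x \<sim> c (j + 4)"
  proof -
    have eq: "c (j + 2 + 2) = c (j + 4)" "c (j + 2 - 2) = c j"
      by (simp_all add: cyc_eq[OF c])
    show ?thesis
      unfolding handle_def eq using x that by blast
  qed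
  ultimately show ?thesis by blast
qed

lemma handle_unique:
  assumes x: "handle c k x" and y: "handle c k y"
  shows "x = y"
proof (rule ccontr)
  assume "x \<noteq> y"
  moreover have "c (k + 2) \<noteq> c (k - 2)"
    by (simp add: cyc_eq[OF c])
  ultimately show False
    using no_square[of x "c (k + 2)" y "c (k - 2)"] x y adj_sym by (auto simp: handle_def)
qed

lemma handle_index:
  assumes "handle c k x" "handle c l x"
  shows "(l - k) mod 7 = 0"
proof -
  have "x \<sim> c (l + 2)" "x \<sim> c (l - 2)"
    using assms(2) by (auto simp: handle_def)
  then have "(l + 2 - k) mod 7 \<in> {2, 5}" "(l - 2 - k) mod 7 \<in> {2, 5}"
    unfolding handle_adj_iff[OF assms(1)] by auto
  then have A: "((l - k) mod 7 + 2) mod 7 \<in> {2, 5}" "((l - k) mod 7 - 2) mod 7 \<in> {2, 5}"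
    unfolding mod_diff_left_eq mod_add_left_eq by (simp_all add: algebra_simps)
  have "d = 0" if "d \<in> {0, 1, 2, 3, 4, 5, 6}" "(d + 2) mod 7 \<in> {2, 5}"
    "(d - 2) mod 7 \<in> {2, 5}" for d :: int
    using that by auto
  from this[OF mod7_cases A] show ?thesis .
qed

lemma nonadj_of_close_neighbours:
  assumes x: "x \<notin> range c" "x \<sim> c i" and y: "y \<notin> range c" "y \<sim> c j"
    and d: "(i - j) mod 7 = 0 \<or> (i - j) mod 7 = 1 \<or> (i - j) mod 7 = 6"
  shows "\<not> x \<sim> y"
proof
  assume xy: "x \<sim> y"
  have "c i = c j \<or> c i \<sim> c j"
    unfolding cyc_adj[OF c] cyc_eq[OF c] using d by simp
  then consider "c i = c j" | "c i \<sim> c j"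
    by argo
  then show False
  proof cases
    case 1
    then show False using no_triangle[OF xy, of "c i"] x y by simp
  next
    case 2
    then show False
      using no_square[OF x(2) 2 y(2)[THEN adj_sym] xy[THEN adj_sym]] x(1) y(1) by blast
  qed
qed

text \<open>
  For every difference of the indices, some neighbour of \<open>x\<close> on the cycle equals or is adjacent to some
  neighbour of \<open>y\<close>; an edge between \<open>x\<close> and \<open>y\<close> would then close a triangle or a 4-cycle.
\<close>

lemma handle_nonadj:
  assumes x: "handle c k x" and l: "handle c l y"
  shows "\<not> x \<sim> y"
proof -
  let ?d = "(l - k) mod 7"
  have y: "handle c (k + ?d) y"
    by (rule handle_offset[OF l])
  have n: "x \<notin> range c" "y \<notin> range c"
    using x y by (auto simp: handle_def)
  have nonadj: ?thesis if "x \<sim> c i" "y \<sim> c j" "(i - j) mod 7 \<in> {0, 1, 6}" for i j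
    using nonadj_of_close_neighbours[OF n(1) that(1) n(2) that(2)] that(3) by blast
  have "?d \<in> {0, 1, 6} \<or> ?d \<in> {2, 3} \<or> ?d \<in> {4, 5}"
    using mod7_cases[of l k] by auto
  then show ?thesis
  proof (elim disjE)
    assume "?d \<in> {0, 1, 6}"
    then show ?thesis
      by (intro nonadj[of "k + 2" "k + ?d + 2"]) (auto simp: handle_adj_iff[OF x] handle_adj_iff[OF y])
  next
    assume "?d \<in> {2, 3}"
    then show ?thesis
      by (intro nonadj[of "k + 5" "k + ?d + 2"]) (auto simp: handle_adj_iff[OF x] handle_adj_iff[OF y])
  next
    assume "?d \<in> {4, 5}"
    then show ?thesis
      by (intro nonadj[of "k + 2" "k + ?d + 5"]) (auto simp: handle_adj_iff[OF x] handle_adj_iff[OF y])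
  qed
qed

text \<open>
  The induced path is \<open>c (k + 3), c (k + 2), x, c (k + 5), c (k + 6), c (k + 7), y\<close>.
\<close>

lemma no_handles_at_distance_2:
  assumes x: "handle c k x" and y: "handle c (k + 2) y"
  shows False
proof -
  have "\<not> x \<sim> y"
    by (rule handle_nonadj[OF x y])
  then show False
    using no_path7[of "c (k + 3)" "c (k + 2)" x "c (k + 5)" "c (k + 6)" "c (k + 7)" y]
    by (simp add: handle_adj_iff[OF x] handle_adj_iff[OF y] adj_handle_iff[OF x] adj_handle_iff[OF y] cyc_adj[OF c])
qed

lemma handle_diff:
  assumes x: "handle c k x" and y: "handle c l y"
  shows "(l - k) mod 7 \<noteq> 2" "(l - k) mod 7 \<noteq> 5"
proof -
  show "(l - k) mod 7 \<noteq> 2"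
    using handle_offset[OF y, of k] no_handles_at_distance_2[OF x] by auto
  have "(k - l) mod 7 \<noteq> 2"
    using handle_offset[OF x, of l] no_handles_at_distance_2[OF y] by auto
  then show "(l - k) mod 7 \<noteq> 5"
    by (auto simp: mod_diff_swap[of k l])
qed

text \<open>
  A neighbour \<open>z\<close> of \<open>m\<close> without neighbours on the cycle would start the induced path
  \<open>z, m, x, c (k + 2), c (k + 1), c k, c (k - 1)\<close>.
\<close>

lemma outer_neighbour:
  assumes m: "outer c m" "m \<sim> x" and x: "handle c k x" and z: "m \<sim> z"
  shows "\<exists>l. handle c l z"
proof (rule ccontr)
  assume no: "\<not> ?thesis"
  have m': "\<not> m \<sim> c j" "\<not> c j \<sim> m" for j
    using m(1) adj_sym by (auto simp: outer_def)
  have "z \<notin> range c"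
    using z m' by auto
  then have z': "\<not> z \<sim> c j" for j
    using no ex_handle by blast
  have "\<not> z \<sim> x" "z \<sim> m"
    using no_triangle m(2) z adj_sym by blast+
  then show False
    using no_path7[of z m x "c (k + 2)" "c (k + 1)" "c k" "c (k + 6)"] m(2)
    by (simp add: m' z' handle_adj_iff[OF x] adj_handle_iff[OF x] cyc_adj[OF c])
qed

text \<open>
  Handles whose indices differ by 3 or 4 share a neighbour on the cycle, so \<open>m\<close> would close a 4-cycle with
  them; differences 2 and 5 do not occur at all, and handles with the same index coincide.
\<close>

lemma outer_neighbour_diff:
  assumes m: "outer c m" and x: "handle c k x" "m \<sim> x" and y: "handle c l y" "m \<sim> y" and ne: "x \<noteq> y"
  shows "(l - k) mod 7 = 1 \<or> (l - k) mod 7 = 6"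
proof -
  let ?d = "(l - k) mod 7"
  have y': "handle c (k + ?d) y"
    by (rule handle_offset[OF y(1)])
  have "False" if "x \<sim> c j" "y \<sim> c j" for j
    using no_square[of m x "c j" y] that x y ne m adj_sym by (auto simp: outer_def)
  then have "?d \<noteq> 3" "?d \<noteq> 4"
    using handle_adj_iff[OF x(1), of "k + 5"] handle_adj_iff[OF y', of "k + 5"]
      handle_adj_iff[OF x(1), of "k + 2"] handle_adj_iff[OF y', of "k + 2"] by auto
  moreover have "?d \<noteq> 0"
    using y' handle_unique[OF x(1)] ne by auto
  ultimately show ?thesis
    using handle_diff[OF x(1) y(1)] mod7_cases[of l k] by auto
qed

lemma outer_pair:
  assumes m: "outer c m" "m \<sim> z" "handle c i z"
  shows "\<exists>k x y. handle c k x \<and> handle c (k + 1) y \<and> m \<sim> x \<and> m \<sim> y"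
proof -
  obtain w where w: "m \<sim> w" "w \<noteq> z"
    using another_neighbour[of m z] m(1) by (auto simp: outer_def)
  obtain j where j: "handle c j w"
    using outer_neighbour[OF m w(1)] by blast
  have "(j - i) mod 7 = 1 \<or> (j - i) mod 7 = 6"
    by (rule outer_neighbour_diff[OF m(1,3,2) j w(1)]) (use w in simp)
  then have "(j - i) mod 7 = 1 \<or> (i - j) mod 7 = 1"
    by (auto simp: mod_diff_swap[of i j])
  then show ?thesis
  proof
    assume "(j - i) mod 7 = 1"
    then have "handle c (i + 1) w" using handle_offset[OF j, of i] by simp
    then show ?thesis using m w by blast
  next
    assume "(i - j) mod 7 = 1"
    then have "handle c (j + 1) z" using handle_offset[OF m(3), of j] by simp
    then show ?thesis using m w j by blast
  qed
qed

text \<open>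
  All neighbours of an outer vertex next to a handle are handles, so crossing edges
  cannot lead any further.
\<close>

lemma C7_cover:
  assumes "z \<in> V"
  shows "z \<in> range c \<or> (\<exists>k. handle c k z) \<or> (outer c z \<and> (\<exists>k x. handle c k x \<and> z \<sim> x))"
proof (rule ccontr)
  assume z: "\<not> (z \<in> range c \<or> (\<exists>k. handle c k z) \<or> (outer c z \<and> (\<exists>k x. handle c k x \<and> z \<sim> x)))"
  let ?U = "{z \<in> V. z \<in> range c \<or> (\<exists>k. handle c k z) \<or> (outer c z \<and> (\<exists>k x. handle c k x \<and> z \<sim> x))}"
  have "c 0 \<in> ?U"
    using cyc_in_V[OF c] by simp
  then have "?U \<subseteq> V" "?U \<noteq> {}" "?U \<noteq> V"
    using assms z by blast+
  from crossing_edge[OF this] obtain x y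
    where x: "x \<in> ?U" and y: "y \<in> V" "y \<notin> ?U" "x \<sim> y"
    by blast
  have yx: "y \<sim> x"
    by (rule adj_sym[OF y(3)])
  have y': "y \<notin> range c" "\<not> (\<exists>k. handle c k y)"
    using y by blast+
  then have n: "\<not> y \<sim> c j" for j
    using ex_handle by blast
  then have o: "outer c y"
    using y' y(1) by (simp add: outer_def)
  have "x \<notin> range c"
    using n yx by auto
  moreover have "\<not> (\<exists>k. handle c k x)"
    using y o yx by blast
  ultimately obtain k w where "outer c x" "handle c k w" "x \<sim> w"
    using x by blast
  then show False
    using outer_neighbour y(3) y'(2) by blast
qed

end


section \<open>Induced subgraphs of F12\<close>

text \<open>
  All of \<open>F6\<close> to \<open>F12\<close> at once: \<open>L\<close> says which of the vertices \<open>x\<^sub>1, \<dots>, x\<^sub>1\<^sub>1\<close> are present. The adjacencies are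
  determined by the roles of the vertices, so only the two edges at \<open>x\<^sub>1\<^sub>0\<close> are assumed.
\<close>

lemma iso_F12_restrict:
  assumes c: "cyc 7 c" and L: "{1..7} \<subseteq> L" "L \<subseteq> {1..11}"
    and X: "\<And>i. i \<le> 7 \<Longrightarrow> X i = c (int i)"
    and X8: "8 \<in> L \<Longrightarrow> handle c 4 (X 8)" and X9: "9 \<in> L \<Longrightarrow> handle c 5 (X 9)"
    and X11: "11 \<in> L \<Longrightarrow> handle c 1 (X 11)"
    and X10: "10 \<in> L \<Longrightarrow> 8 \<in> L \<and> 9 \<in> L \<and> outer c (X 10) \<and> X 10 \<sim> X 8 \<and> X 10 \<sim> X 9"
    and cover: "V \<subseteq> X ` L"
  shows "digraph_iso (with_proj G) (F12 \<restriction> (Vx ` L))"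
proof -
  let ?E = "cycle_edges Vx 7 \<union>
      {(Vx 8, Vx 2), (Vx 8, Vx 6), (Vx 9, Vx 3), (Vx 9, Vx 7),
       (Vx 10, Vx 8), (Vx 10, Vx 9), (Vx 11, Vx 3), (Vx 11, Vx 6)}"
  have c7: "cyc (int 7) c" using c by simp
  note hc = handle_adj_iff[OF c X8] handle_adj_iff[OF c X9] handle_adj_iff[OF c X11]
    adj_handle_iff[OF c X8] adj_handle_iff[OF c X9] adj_handle_iff[OF c X11]
  have X10c: "\<not> X 10 \<sim> c j" "\<not> c j \<sim> X 10" if "10 \<in> L" for j
    using X10[OF that] adj_sym by (auto simp: outer_def)
  have X10_11: "\<not> X 10 \<sim> X 11" "\<not> X 11 \<sim> X 10" if "10 \<in> L" "11 \<in> L"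
  proof -
    note t = X10[OF that(1)]
    have h: "handle c 4 (X 8)" "handle c 1 (X 11)"
      using t X8 X11 that by auto
    have "X 8 \<noteq> X 11"
      using h handle_index[OF c, of 4 "X 8" 1] by auto
    then show "\<not> X 10 \<sim> X 11"
      using outer_neighbour_diff[OF c, of "X 10" 4 "X 8" 1 "X 11"] t h by auto
    then show "\<not> X 11 \<sim> X 10"
      by (rule not_adj_sym)
  qed
  have X10_8: "X 10 \<sim> X 8" "X 8 \<sim> X 10" "X 10 \<sim> X 9" "X 9 \<sim> X 10" if "10 \<in> L"
    using X10[OF that] adj_sym by blast+
  note hh = handle_nonadj[OF c X8 X9] handle_nonadj[OF c X9 X8] handle_nonadj[OF c X8 X11]
    handle_nonadj[OF c X11 X8] handle_nonadj[OF c X9 X11] handle_nonadj[OF c X11 X9]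
  have range: "X i \<in> range c \<longleftrightarrow> i \<le> 7" if "i \<in> L" for i
  proof -
    have "i \<le> 7 \<or> i = 8 \<or> i = 9 \<or> i = 10 \<or> i = 11"
      using that L(2) by auto
    then show ?thesis
      using X[of i] X8 X9 X10 X11 that by (auto simp: handle_def outer_def)
  qed
  have ne: "X 8 \<noteq> X 9" if "8 \<in> L" "9 \<in> L"
    using handle_index[OF c X8[OF that(1)], of 5] X9[OF that(2)] by auto
  have ne': "X 8 \<noteq> X 11" if "8 \<in> L" "11 \<in> L"
    using handle_index[OF c X8[OF that(1)], of 1] X11[OF that(2)] by auto
  have ne'': "X 9 \<noteq> X 11" if "9 \<in> L" "11 \<in> L"
    using handle_index[OF c X9[OF that(1)], of 1] X11[OF that(2)] by auto
  have ne10: "X 10 \<noteq> X i" if "10 \<in> L" "i = 8 \<or> i = 9 \<or> i = 11" "i \<in> L" for i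
    using X10[OF that(1)] X8 X9 X11 that(2,3) by (auto simp: handle_def outer_def)
  have inj: "i = j" if ij: "i \<in> L" "j \<in> L" "X i = X j" for i j
  proof (cases "i \<le> 7")
    case True
    then have "j \<le> 7" using range ij by metis
    moreover have "i \<in> {1..7}" "j \<in> {1..7}"
      using L(2) ij True \<open>j \<le> 7\<close> by auto
    ultimately show ?thesis
      using inj_on_eq_iff[OF cyc_inj_on[OF c7], of i j] ij(3) X True by simp
  next
    case False
    then have "\<not> j \<le> 7" using range ij by metis
    then have "i \<in> {8,9,10,11}" "j \<in> {8,9,10,11}"
      using False ij L(2) by auto
    then show ?thesis
      using ij ne ne' ne'' ne10 by (elim insertE emptyE) (simp_all, metis+)
  qed
  have adj: "X i \<sim> X j \<longleftrightarrow> (Vx i, Vx j) \<in> ?E \<or> (Vx j, Vx i) \<in> ?E" if ij: "i \<in> L" "j \<in> L" for i j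
  proof -
    have ij': "i \<in> {1..7} \<or> i \<in> {8,9,10,11}" "j \<in> {1..7} \<or> j \<in> {8,9,10,11}"
      using L(2) ij by auto
    have e: "(Vx k, Vx l) \<notin> cycle_edges Vx 7" if "k \<in> {8,9,10,11} \<or> l \<in> {8,9,10,11}" for k l
      using that cycle_edges_subset[of Vx 7] by auto
    have 1: ?thesis if "i \<in> {1..7}" "j \<in> {1..7}"
      using cyc_cycle_edges[OF c7 inj_Vx that] X[of i] X[of j] that by auto
    have "\<forall>k\<in>{1..7}. \<forall>l\<in>{8,9,10,11}. l \<in> L \<longrightarrow>
        (X k \<sim> X l \<longleftrightarrow> (Vx k, Vx l) \<in> ?E \<or> (Vx l, Vx k) \<in> ?E) \<and>
        (X l \<sim> X k \<longleftrightarrow> (Vx l, Vx k) \<in> ?E \<or> (Vx k, Vx l) \<in> ?E)"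
      by (simp add: ivl_numeral e X hc X10c)
    note 2 = this[THEN bspec, THEN bspec, THEN mp]
    have "\<forall>k\<in>{8,9,10,11}. \<forall>l\<in>{8,9,10,11}. k \<in> L \<longrightarrow> l \<in> L \<longrightarrow>
        (X k \<sim> X l \<longleftrightarrow> (Vx k, Vx l) \<in> ?E \<or> (Vx l, Vx k) \<in> ?E)"
      by (simp add: e hh X10_8 X10_11)
    note 3 = this[THEN bspec, THEN bspec, THEN mp, THEN mp]
    from ij' consider "i \<in> {1..7}" "j \<in> {1..7}" | "i \<in> {1..7}" "j \<in> {8,9,10,11}"
      | "j \<in> {1..7}" "i \<in> {8,9,10,11}" | "i \<in> {8,9,10,11}" "j \<in> {8,9,10,11}"
      by argo
    then show ?thesis
    proof cases
      case a: 1 show ?thesis by (rule 1[OF a])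
    next
      case a: 2 show ?thesis by (rule 2[OF a ij(2), THEN conjunct1])
    next
      case a: 3 show ?thesis by (rule 2[OF a ij(1), THEN conjunct2])
    next
      case a: 4 show ?thesis by (rule 3[OF a ij])
    qed
  qed
  show ?thesis
    unfolding F12_def ugraph_restrict
  proof (rule iso_ugraph)
    define g where "g l = X (inv Vx l)" for l
    have g: "g (Vx i) = X i" for i
      using inj_Vx by (simp add: g_def)
    show "inj_on g (Vx ` L)"
      by (auto simp: inj_on_def g dest: inj)
    have "X i \<in> V" if "i \<in> L" for i
    proof -
      have "i \<le> 7 \<or> i = 8 \<or> i = 9 \<or> i = 10 \<or> i = 11"
        using that L(2) by auto
      then show ?thesis
        using X[of i] X8 X9 X10 X11 that cyc_in_V[OF c] handle_in_V[OF c] by (auto simp: outer_def)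
    qed
    then show "g ` Vx ` L = V"
      using cover by (auto simp: image_image g)
    fix u v assume "u \<in> Vx ` L" "v \<in> Vx ` L"
    then show "g u \<sim> g v \<longleftrightarrow> (u, v) \<in> {e \<in> ?E. fst e \<in> Vx ` L \<and> snd e \<in> Vx ` L} \<or>
        (v, u) \<in> {e \<in> ?E. fst e \<in> Vx ` L \<and> snd e \<in> Vx ` L}"
    proof (elim imageE, hypsubst_thin)
      fix i j assume ij: "i \<in> L" "j \<in> L"
      show "g (Vx i) \<sim> g (Vx j) \<longleftrightarrow> (Vx i, Vx j) \<in> {e \<in> ?E. fst e \<in> Vx ` L \<and> snd e \<in> Vx ` L} \<or>
          (Vx j, Vx i) \<in> {e \<in> ?E. fst e \<in> Vx ` L \<and> snd e \<in> Vx ` L}"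
        using adj[OF ij] imageI[OF ij(1), of Vx] imageI[OF ij(2), of Vx]
        by (simp only: g mem_Collect_eq fst_conv snd_conv simp_thms)
    qed
  qed auto
qed

text \<open>
  The indices of the handles are pairwise at cyclic distance 1 or 3. Two indices at distance 1,
  rotated to 4 and 5, leave room for one more handle only, at 1. If there is no such pair, a pair at
  distance 3, rotated to 5 and 8, leaves room for none. An outer vertex needs two handles at
  distance 1 and is determined by them.
\<close>

lemma classify_C7:
  assumes c: "cyc 7 c"
  shows "\<exists>F\<in>frak_F. digraph_iso (with_proj G) F"
proof -
  let ?H = "\<lambda>k. \<exists>x. handle c k x"
  consider (consec) k where "?H k" "?H (k + 1)"
    | (third) k where "\<forall>k. \<not> (?H k \<and> ?H (k + 1))" "?H k" "?H (k + 3)"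
    | (single) k where "\<forall>k. \<not> (?H k \<and> ?H (k + 1))" "\<forall>k. \<not> (?H k \<and> ?H (k + 3))" "?H k"
    | (none) "\<forall>k. \<not> ?H k"
    by blast
  then show ?thesis
  proof cases
    case consec
    define d where "d = (\<lambda>j. c (j + (k - 4)))"
    have d: "cyc 7 d" unfolding d_def by (rule cyc_shift[OF c])
    obtain x8 x9 where x: "handle c k x8" "handle c (k + 1) x9"
      using consec by blast
    have "4 + (k - 4) = k" "5 + (k - 4) = k + 1"
      by simp_all
    then have x8: "handle d 4 x8" and x9: "handle d 5 x9"
      unfolding d_def handle_shift using x by metis+
    \<comment> \<open>Differences 2 and 5 are excluded both from 4 and from 5.\<close>
    have idx: "(l - 4) mod 7 \<in> {0, 1, 4}" if z: "handle d l z" for l z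
    proof -
      have "(l - 5) mod 7 = ((l - 4) mod 7 - 1) mod 7"
        unfolding mod_diff_left_eq by simp
      then have A: "(l - 4) mod 7 \<noteq> 2" "(l - 4) mod 7 \<noteq> 5"
        "((l - 4) mod 7 - 1) mod 7 \<noteq> 2" "((l - 4) mod 7 - 1) mod 7 \<noteq> 5"
        using handle_diff[OF d x8 z] handle_diff[OF d x9 z] by metis+
      have "D \<in> {0, 1, 4}" if "D \<in> {0, 1, 2, 3, 4, 5, 6}" "D \<noteq> 2" "D \<noteq> 5"
        "(D - 1) mod 7 \<noteq> 2" "(D - 1) mod 7 \<noteq> 5" for D :: int
        using that by auto
      from this[OF mod7_cases A] show ?thesis .
    qed
    have handles: "z = x8 \<or> z = x9 \<or> handle d 1 z" if z: "handle d l z" for l z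
    proof -
      have "handle d 4 z \<or> handle d 5 z \<or> handle d 8 z"
        using idx[OF z] handle_offset[OF d z, of 4] by auto
      moreover have "handle d 1 z" if "handle d 8 z"
        by (rule handle_cong[OF d that]) simp
      ultimately show ?thesis
        using handle_unique[OF d x8] handle_unique[OF d x9] by metis
    qed
    have outers: "z \<sim> x8 \<and> z \<sim> x9" if o: "outer d z" "handle d l w" "z \<sim> w" for z l w
    proof -
      obtain j x y where xy: "handle d j x" "handle d (j + 1) y" "z \<sim> x" "z \<sim> y"
        using outer_pair[OF d o(1,3,2)] by blast
      have "(j + 1 - 4) mod 7 = ((j - 4) mod 7 + 1) mod 7"
        unfolding mod_add_left_eq by simp
      then have "(j - 4) mod 7 = 0"
        using idx[OF xy(1)] idx[OF xy(2)] by auto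
      then have "handle d 4 x" "handle d 5 y"
        by (intro handle_cong[OF d xy(1)] handle_cong[OF d xy(2)]; simp add: mod_diff_swap[of 4 j])+
      then have "x = x8" "y = x9"
        using handle_unique[OF d] x8 x9 by metis+
      then show ?thesis using xy by simp
    qed
    have outer_unique: "z = z'" if "outer d z" "z \<sim> x8" "z \<sim> x9" "outer d z'" "z' \<sim> x8" "z' \<sim> x9" for z z'
    proof (rule ccontr)
      assume "z \<noteq> z'"
      moreover have "x8 \<noteq> x9"
        using handle_index[OF d x8, of 5] x9 by auto
      ultimately show False
        using no_square[of z x8 z' x9] that adj_sym by blast
    qed
    \<comment> \<open>The optional vertices: the values at 10 and 11 matter only when \<open>L\<close> contains these indices.\<close>
    define X where "X i = (if i \<le> 7 then d (int i) else if i = 8 then x8 else if i = 9 then x9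
      else if i = 10 then (SOME z. outer d z \<and> z \<sim> x8 \<and> z \<sim> x9) else SOME z. handle d 1 z)" for i :: nat
    have X: "X i = d (int i)" if "i \<le> 7" for i using that by (simp add: X_def)
    have X8: "X 8 = x8" "X 9 = x9" by (simp_all add: X_def)
    define L where "L = {1..9} \<union> (if \<exists>z. outer d z \<and> z \<sim> x8 \<and> z \<sim> x9 then {10} else {})
      \<union> (if \<exists>z. handle d 1 z then {11::nat} else {})"
    have X10: "outer d (X 10) \<and> X 10 \<sim> x8 \<and> X 10 \<sim> x9" if "10 \<in> L"
    proof -
      have "\<exists>z. outer d z \<and> z \<sim> x8 \<and> z \<sim> x9"
        using that by (auto simp: L_def split: if_splits)
      then have "outer d (SOME z. outer d z \<and> z \<sim> x8 \<and> z \<sim> x9) \<and>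
          (SOME z. outer d z \<and> z \<sim> x8 \<and> z \<sim> x9) \<sim> x8 \<and> (SOME z. outer d z \<and> z \<sim> x8 \<and> z \<sim> x9) \<sim> x9"
        by (rule someI_ex)
      then show ?thesis by (simp add: X_def)
    qed
    have X11: "handle d 1 (X 11)" if "11 \<in> L"
    proof -
      have "\<exists>z. handle d 1 z"
        using that by (auto simp: L_def split: if_splits)
      then have "handle d 1 (SOME z. handle d 1 z)"
        by (rule someI_ex)
      then show ?thesis by (simp add: X_def)
    qed
    have cover: "V \<subseteq> X ` L"
    proof
      fix z assume "z \<in> V"
      then consider "z \<in> range d" | l where "handle d l z" | l w where "outer d z" "handle d l w" "z \<sim> w"
        using C7_cover[OF d] by blast
      then show "z \<in> X ` L"
      proof cases
        case 1
        have "cyc (int 7) d" using d by simp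
        from 1 obtain i where "i \<in> {1..7}" "z = d (int i)"
          unfolding cyc_range[OF \<open>cyc (int 7) d\<close>] by blast
        then show ?thesis
          using X[of i] by (intro image_eqI[of _ _ i]) (auto simp: L_def)
      next
        case 2
        then consider "z = x8" | "z = x9" | "handle d 1 z" using handles by blast
        then show ?thesis
        proof cases
          case 1 then show ?thesis by (intro image_eqI[of _ _ 8]) (auto simp: L_def X8)
        next
          case 2 then show ?thesis by (intro image_eqI[of _ _ 9]) (auto simp: L_def X8)
        next
          case 3
          then have "11 \<in> L" by (auto simp: L_def)
          then show ?thesis
            using handle_unique[OF d 3 X11] by blast
        qed
      next
        case 3
        then have z: "z \<sim> x8" "z \<sim> x9" using outers by blast+
        then have "10 \<in> L" using 3 by (auto simp: L_def)
        then show ?thesis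
          using outer_unique[OF 3(1) z] X10 by blast
      qed
    qed
    have "digraph_iso (with_proj G) (F12 \<restriction> (Vx ` L))"
      by (rule iso_F12_restrict[OF d _ _ X])
        (use x8 x9 X8 X10 X11 cover in \<open>auto simp: L_def split: if_splits\<close>)
    moreover have "L = {1..9} \<or> L = {1..10} \<or> L = {1..9} \<union> {11} \<or> L = {1..11}"
      by (auto simp: L_def)
    moreover have "F12 \<restriction> (Vx ` {1..11}) = F12"
      by (rule F12_whole)
    ultimately have "digraph_iso (with_proj G) F8 \<or> digraph_iso (with_proj G) F9 \<or>
        digraph_iso (with_proj G) F11 \<or> digraph_iso (with_proj G) F12"
      unfolding F8_def F9_def F11_def by metis
    then show ?thesis
      by (auto simp: frak_F_def)
  next
    case third
    define d where "d = (\<lambda>j. c (j + (k - 5)))"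
    have d: "cyc 7 d" unfolding d_def by (rule cyc_shift[OF c])
    have no: "\<not> (handle d j x \<and> handle d (j + 1) y)" for j x y
    proof -
      have "j + 1 + (k - 5) = j + (k - 5) + 1" by simp
      then show ?thesis using third(1) unfolding d_def handle_shift by metis
    qed
    have no': "(l - j) mod 7 \<noteq> 1" if "handle d j x" "handle d l y" for j l x y
      using no[of j x y] handle_offset[OF d that(2), of j] that(1) by auto
    obtain x9 y where x: "handle c k x9" "handle c (k + 3) y"
      using third by blast
    have "5 + (k - 5) = k" "8 + (k - 5) = k + 3"
      by simp_all
    then have x9: "handle d 5 x9" and y: "handle d 8 y"
      unfolding d_def handle_shift using x by metis+
    have x11: "handle d 1 y"
      by (rule handle_cong[OF d y]) simp
    have handles: "z = x9 \<or> z = y" if z: "handle d l z" for l z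
    proof -
      have n6: "(l - 5) mod 7 \<noteq> 6"
      proof
        assume 6: "(l - 5) mod 7 = 6"
        have "(5 - l) mod 7 = 1"
          unfolding mod_diff_swap[of 5 l] 6 by simp
        then show False
          using no'[OF z x9] by simp
      qed
      have "(l - 8) mod 7 = ((l - 5) mod 7 - 3) mod 7"
        unfolding mod_diff_left_eq by simp
      then have A: "(l - 5) mod 7 \<noteq> 1" "(l - 5) mod 7 \<noteq> 2" "(l - 5) mod 7 \<noteq> 5"
        "((l - 5) mod 7 - 3) mod 7 \<noteq> 1" "(l - 5) mod 7 \<noteq> 6"
        using handle_diff[OF d x9 z] no'[OF x9 z] no'[OF y z] n6 by metis+
      have "D = 0 \<or> D = 3" if "D \<in> {0, 1, 2, 3, 4, 5, 6}" "D \<noteq> 1" "D \<noteq> 2" "D \<noteq> 5"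
        "(D - 3) mod 7 \<noteq> 1" "D \<noteq> 6" for D :: int
        using that by auto
      from this[OF mod7_cases A] have "handle d 5 z \<or> handle d 8 z"
        using handle_offset[OF d z, of 5] by auto
      then show ?thesis
        using handle_unique[OF d x9] handle_unique[OF d y] by metis
    qed
    define X where "X i = (if i \<le> 7 then d (int i) else if i = 9 then x9 else y)" for i :: nat
    have X: "X i = d (int i)" if "i \<le> 7" for i using that by (simp add: X_def)
    have cover: "V \<subseteq> X ` ({1..7} \<union> {9, 11})"
    proof
      fix z assume "z \<in> V"
      then consider "z \<in> range d" | l where "handle d l z" | l w where "outer d z" "handle d l w" "z \<sim> w"
        using C7_cover[OF d] by blast
      then show "z \<in> X ` ({1..7} \<union> {9, 11})"
      proof cases
        case 1
        have "cyc (int 7) d" using d by simp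
        from 1 obtain i where "i \<in> {1..7}" "z = d (int i)"
          unfolding cyc_range[OF \<open>cyc (int 7) d\<close>] by blast
        then show ?thesis
          using X[of i] by (intro image_eqI[of _ _ i]) auto
      next
        case 2
        then consider "z = x9" | "z = y" using handles by blast
        then show ?thesis
        proof cases
          case 1 then show ?thesis by (intro image_eqI[of _ _ 9]) (auto simp: X_def)
        next
          case 2 then show ?thesis by (intro image_eqI[of _ _ 11]) (auto simp: X_def)
        qed
      next
        case 3
        then show ?thesis using outer_pair[OF d 3(1,3,2)] no by blast
      qed
    qed
    have "digraph_iso (with_proj G) F10"
      unfolding F10_def
      by (rule iso_F12_restrict[OF d _ _ X]) (use x9 x11 cover in \<open>auto simp: X_def\<close>)
    then show ?thesis
      by (auto simp: frak_F_def)
  next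
    case single
    define d where "d = (\<lambda>j. c (j + (k - 4)))"
    have d: "cyc 7 d" unfolding d_def by (rule cyc_shift[OF c])
    have no: "\<not> (handle d j x \<and> handle d (j + 1) y)" "\<not> (handle d j x \<and> handle d (j + 3) y)" for j x y
    proof -
      have "j + 1 + (k - 4) = j + (k - 4) + 1" "j + 3 + (k - 4) = j + (k - 4) + 3" by simp_all
      then show "\<not> (handle d j x \<and> handle d (j + 1) y)" "\<not> (handle d j x \<and> handle d (j + 3) y)"
        using single(1,2) unfolding d_def handle_shift by metis+
    qed
    have no': "(l - j) mod 7 \<noteq> 1 \<and> (l - j) mod 7 \<noteq> 3" if "handle d j x" "handle d l y" for j l x y
      using no[of j x y] handle_offset[OF d that(2), of j] that(1) by auto
    have "4 + (k - 4) = k"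
      by simp
    then obtain x8 where x8: "handle d 4 x8"
      unfolding d_def handle_shift using single(3) by metis
    have handles: "z = x8" if z: "handle d l z" for l z
    proof -
      have "(4 - l) mod 7 = 0"
        using handle_diff[OF d z x8] no'[OF x8 z] no'[OF z x8] mod7_cases[of 4 l]
        by (auto simp: mod_diff_swap[of l 4])
      then have "handle d 4 z"
        by (rule handle_cong[OF d z])
      then show ?thesis
        using handle_unique[OF d] x8 by blast
    qed
    define X where "X i = (if i \<le> 7 then d (int i) else x8)" for i :: nat
    have X: "X i = d (int i)" if "i \<le> 7" for i using that by (simp add: X_def)
    have cover: "V \<subseteq> X ` {1..8}"
    proof
      fix z assume "z \<in> V"
      then consider "z \<in> range d" | l where "handle d l z" | l w where "outer d z" "handle d l w" "z \<sim> w"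
        using C7_cover[OF d] by blast
      then show "z \<in> X ` {1..8}"
      proof cases
        case 1
        have "cyc (int 7) d" using d by simp
        from 1 obtain i where "i \<in> {1..7}" "z = d (int i)"
          unfolding cyc_range[OF \<open>cyc (int 7) d\<close>] by blast
        then show ?thesis
          using X[of i] by (intro image_eqI[of _ _ i]) auto
      next
        case 2
        then have "z = x8" using handles by blast
        then show ?thesis by (intro image_eqI[of _ _ 8]) (auto simp: X_def)
      next
        case 3
        then show ?thesis using outer_pair[OF d 3(1,3,2)] no by blast
      qed
    qed
    have "digraph_iso (with_proj G) F7"
      unfolding F7_def
      by (rule iso_F12_restrict[OF d _ _ X]) (use x8 cover in \<open>auto simp: X_def\<close>)
    then show ?thesis
      by (auto simp: frak_F_def)
  next
    case none
    then have "V \<subseteq> range c"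
      using C7_cover[OF c] by blast
    moreover have "cyc (int 7) c" using c by simp
    ultimately have cover: "V \<subseteq> (\<lambda>i. c (int i)) ` {1..7}"
      using cyc_range by blast
    have "digraph_iso (with_proj G) F6"
      unfolding F6_def
      by (rule iso_F12_restrict[OF c _ _ refl]) (use cover in auto)
    then show ?thesis
      by (auto simp: frak_F_def)
  qed
qed

section \<open>Conclusion\<close>

text \<open>
  A 7-cycle may be present together with shorter cycles, and a 5-cycle together with a 6-cycle (as in the
  Petersen graph). The order 7, 5, 6 makes each analysis start from the absence of the cycles treated
  before that it needs.
\<close>

theorem classification: "\<exists>F\<in>frak_F. digraph_iso (with_proj G) F"
proof -
  obtain n c where c: "cyc n c"
    using ex_cyc by blast
  consider "\<exists>c. cyc 7 c" | "\<not> (\<exists>c. cyc 7 c)" "\<exists>c. cyc 5 c" | "\<not> (\<exists>c. cyc 5 c)" "\<exists>c. cyc 6 c"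
    using c cyc_length[OF c] by blast
  then show ?thesis
    using classify_C7 classify_C5 classify_C6 by cases blast+
qed

end

theorem lemma3p4:
  fixes G :: "'a pair_pre_digraph"
  assumes "pair_graph G"
    and "connected (with_proj G)"
    and "induced_free (with_proj (path_graph 7)) (with_proj G)"
    and "induced_free (with_proj (cycle_graph 4)) (with_proj G)"
    and "induced_free (with_proj (cycle_graph 3)) (with_proj G)"
    and "\<not> (\<exists>K. clique_cutset (with_proj G) K)"
    and "\<not> complete_digraph (card (pverts G)) (with_proj G)"
  shows "\<exists>F \<in> frak_F. digraph_iso (with_proj G) F"
proof -
  interpret sparse_graph G
    using assms by (simp add: sparse_graph_def sparse_graph_axioms_def)
  show ?thesis
    by (rule classification)
qed

end
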